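(* Let $S\subset\mathbb{N}^d$ be the semigroup generated by $\mathbf{m}_1,\dots,\mathbf{m}_n$, let $\mathbf{m}\in S$, and let $\ell$ be a positive integer relatively prime to a component of $\mathbf{m}$. If $\mathcal{G}$ is a reduced Gröbner basis for $I_{\overline{S}}$ with respect to a term order $\succ$ making $x_0$ the smallest variable and $\ell\geq\delta(\mathbf{m})$, then $\mathcal{G}\cup\{F\}$ is a reduced Gröbner basis for $I_{\overline{S}_{\ell,\mathbf{m}}}$ with respect to a term order refining $\succ$ and making $x_{n+1}$ the biggest variable, and thus $I_{\overline{S}_{\ell,\mathbf{m}}}=I_{\overline{S}}+\langle F\rangle$, where $F=x_{n+1}^{\ell}-x_0^{\ell-\delta(\mathbf{m})}x_1^{s_1}\cdots x_n^{s_n}$ and $s_1,\dots,s_n$ are non-negative integers with $\mathbf{m}=s_1\mathbf{m}_1+\cdots+s_n\mathbf{m}_n$ and $s_1+\cdots+s_n=\delta(\mathbf{m})$.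
   Context: $K$ is an algebraically closed field of any characteristic and $\mathbb{N}$ denotes the non-negative integers. For a subsemigroup $S$ of $\mathbb{N}^d$ generated by $\mathbf{m}_1,\dots,\mathbf{m}_n$, set $\deg_S(x_1^{b_1}\cdots x_n^{b_n})=b_1\mathbf{m}_1+\cdots+b_n\mathbf{m}_n$. The toric ideal $I_S$ of $S$ is the prime ideal in $K[x_1,\dots,x_n]$ generated by the binomials $\mathbf{x}^{\mathbf{a}}-\mathbf{x}^{\mathbf{b}}$ with $\deg_S(\mathbf{x}^{\mathbf{a}})=\deg_S(\mathbf{x}^{\mathbf{b}})$, and the toric variety $V_S\subset\mathbb{A}^n$ is its set of zeroes. $S_{\ell,\mathbf{m}}$ denotes the affine semigroup generated by $\ell\mathbf{m}_1,\dots,\ell\mathbf{m}_n$ and $\mathbf{m}$, so that $I_{S_{\ell,\mathbf{m}}}\subset K[x_1,\dots,x_{n+1}]$ with $x_{n+1}$ of degree $\mathbf{m}$. $I_{\overline{S}}\subset K[x_0,\dots,x_n]$ is the homogeneous ideal of the projective closure $V_{\overline{S}}=\overline{V_S}\subset\mathbb{P}^n$ of $V_S$, with homogenizing variable $x_0$; likewise $I_{\overline{S}_{\ell,\mathbf{m}}}\subset K[x_0,\dots,x_{n+1}]$ is the homogeneous ideal of the projective closure of $V_{S_{\ell,\mathbf{m}}}$ in $\mathbb{P}^{n+1}$. In the sum $I_{\overline{S}}+\langle F\rangle$, $I_{\overline{S}}$ stands for the ideal it generates in $K[x_0,\dots,x_{n+1}]$. For $\mathbf{m}\in S$, $\delta(\mathbf{m})$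 is the minimum of all the sums $s_1+\cdots+s_n$ where $s_1,\dots,s_n$ are non-negative integers such that $\mathbf{m}=s_1\mathbf{m}_1+\cdots+s_n\mathbf{m}_n$.
   Formalization: G∪{F} need not be reduced (S=⟨1,2,3⟩, m=3, ℓ=2, lex). Proved: for every s it is a minimal Gröbner basis, reduced iff the tail of F is not in the initial ideal of I_S̄; it is reduced for some s if, in each degree, a higher power of x_0 is smaller. *)

theory Defs
  imports
    "HOL-Library.Poly_Mapping"
    "HOL-Library.FuncSet"
    "HOL-Algebra.Ideal"
    "HOL-Computational_Algebra.Polynomial"
    "HOL-Analysis.Finite_Cartesian_Product"
begin

section \<open>Multivariate polynomials\<close>

text \<open>
  A monomial is its finitely supported exponent vector, so the product of monomials is
  \<^term>\<open>(+)\<close> and the monomial 1 is \<^term>\<open>0\<close>.  All variables $x_i$ with \<open>i :: nat\<close> live in one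
  ambient ring; the polynomial ring in finitely many of them is the subring
  \<open>poly_ring X\<close> with carrier \<open>polys X\<close>, and ideals are always ideals of such a \<open>poly_ring X\<close>.
\<close>

type_synonym mono = "nat \<Rightarrow>\<^sub>0 nat"
type_synonym 'k mpoly = "mono \<Rightarrow>\<^sub>0 'k"

definition monomials :: "nat set \<Rightarrow> mono set" where
  "monomials X = {t. Poly_Mapping.keys t \<subseteq> X}"

definition polys :: "nat set \<Rightarrow> 'k::comm_ring_1 mpoly set" where
  "polys X = {p. Poly_Mapping.keys p \<subseteq> monomials X}"

definition poly_ring :: "nat set \<Rightarrow> 'k::comm_ring_1 mpoly ring" where
  "poly_ring X = \<lparr>carrier = polys X, monoid.mult = (*), one = 1, zero = 0, add = (+)\<rparr>"

definition mono_poly :: "mono \<Rightarrow> 'k::comm_ring_1 mpoly" where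
  "mono_poly t = Poly_Mapping.single t 1"

definition Var :: "nat \<Rightarrow> 'k::comm_ring_1 mpoly" where
  "Var i = mono_poly (Poly_Mapping.single i 1)"

definition eval :: "'k::comm_ring_1 mpoly \<Rightarrow> (nat \<Rightarrow> 'k) \<Rightarrow> 'k" where
  "eval p a = (\<Sum>t\<in>Poly_Mapping.keys p. Poly_Mapping.lookup p t *
     (\<Prod>i\<in>Poly_Mapping.keys t. a i ^ Poly_Mapping.lookup t i))"

definition total_degree :: "mono \<Rightarrow> nat" where
  "total_degree t = (\<Sum>i\<in>Poly_Mapping.keys t. Poly_Mapping.lookup t i)"

definition homogeneous :: "'k::comm_ring_1 mpoly \<Rightarrow> bool" where
  "homogeneous p \<longleftrightarrow> (\<exists>e. \<forall>t\<in>Poly_Mapping.keys p. total_degree t = e)"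


section \<open>Affine semigroups and toric varieties\<close>

text \<open>The generators $\mathbf{m}_1,\dots,\mathbf{m}_n$ are \<open>m 1, \<dots>, m n\<close>; other values of \<open>m\<close> are
  irrelevant.\<close>

definition comb :: "nat \<Rightarrow> (nat \<Rightarrow> nat ^ 'd) \<Rightarrow> (nat \<Rightarrow> nat) \<Rightarrow> nat ^ 'd" where
  "comb n m s = (\<Sum>i\<in>{1..n}. s i *s m i)"

definition affine_semigroup :: "nat \<Rightarrow> (nat \<Rightarrow> nat ^ 'd) \<Rightarrow> (nat ^ 'd) set" where
  "affine_semigroup n m = range (comb n m)"

definition toric_ideal :: "nat \<Rightarrow> (nat \<Rightarrow> nat ^ 'd) \<Rightarrow> 'k::comm_ring_1 mpoly set" where
  "toric_ideal n m = genideal (poly_ring {1..n})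
     {mono_poly a - mono_poly b | a b. a \<in> monomials {1..n} \<and> b \<in> monomials {1..n} \<and>
        comb n m (Poly_Mapping.lookup a) = comb n m (Poly_Mapping.lookup b)}"

text \<open>Points of $\mathbb{A}^n$ are the functions in \<^term>\<open>{1..n} \<rightarrow>\<^sub>E UNIV\<close>.\<close>

definition toric_variety :: "nat \<Rightarrow> (nat \<Rightarrow> nat ^ 'd) \<Rightarrow> (nat \<Rightarrow> 'k::comm_ring_1) set" where
  "toric_variety n m = {a \<in> {1..n} \<rightarrow>\<^sub>E UNIV. \<forall>f\<in>toric_ideal n m. eval f a = 0}"

definition delta :: "nat \<Rightarrow> (nat \<Rightarrow> nat ^ 'd) \<Rightarrow> nat ^ 'd \<Rightarrow> nat" where
  "delta n m v = (LEAST k. \<exists>s. v = comb n m s \<and> k = (\<Sum>i\<in>{1..n}. s i))"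

definition minimal_reps :: "nat \<Rightarrow> (nat \<Rightarrow> nat ^ 'd) \<Rightarrow> nat ^ 'd \<Rightarrow> (nat \<Rightarrow> nat) set" where
  "minimal_reps n m v = {s. v = comb n m s \<and> (\<Sum>i\<in>{1..n}. s i) = delta n m v}"

definition ext_gens :: "nat \<Rightarrow> nat \<Rightarrow> (nat \<Rightarrow> nat ^ 'd) \<Rightarrow> nat ^ 'd \<Rightarrow> nat \<Rightarrow> nat ^ 'd" where
  "ext_gens n l m v i = (if i = n + 1 then v else l *s m i)"


section \<open>Projective closure\<close>

definition hom_coords :: "nat \<Rightarrow> (nat \<Rightarrow> 'k::field) set" where
  "hom_coords n = {a \<in> {0..n} \<rightarrow>\<^sub>E UNIV. \<exists>i\<in>{0..n}. a i \<noteq> 0}"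

definition proj_rel :: "nat \<Rightarrow> (nat \<Rightarrow> 'k::field) rel" where
  "proj_rel n = {(a, b). a \<in> hom_coords n \<and> b \<in> hom_coords n \<and>
     (\<exists>c. c \<noteq> 0 \<and> (\<forall>i\<in>{0..n}. b i = c * a i))}"

definition proj_space :: "nat \<Rightarrow> (nat \<Rightarrow> 'k::field) set set" where
  "proj_space n = hom_coords n // proj_rel n"

definition vanishes_at :: "'k::field mpoly \<Rightarrow> (nat \<Rightarrow> 'k) set \<Rightarrow> bool" where
  "vanishes_at f P \<longleftrightarrow> (\<forall>a\<in>P. eval f a = 0)"

definition proj_closed :: "nat \<Rightarrow> (nat \<Rightarrow> 'k::field) set set \<Rightarrow> bool" where
  "proj_closed n Z \<longleftrightarrow> (\<exists>B \<subseteq> {f \<in> polys {0..n}. homogeneous f}.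
     Z = {P \<in> proj_space n. \<forall>f\<in>B. vanishes_at f P})"

definition affine_chart :: "nat \<Rightarrow> (nat \<Rightarrow> 'k::field) \<Rightarrow> (nat \<Rightarrow> 'k) set" where
  "affine_chart n a = proj_rel n `` {\<lambda>i\<in>{0..n}. if i = 0 then 1 else a i}"

definition proj_closure :: "nat \<Rightarrow> (nat \<Rightarrow> 'k::field) set \<Rightarrow> (nat \<Rightarrow> 'k) set set" where
  "proj_closure n V = proj_closed n hull (affine_chart n ` V)"

definition hom_ideal :: "nat \<Rightarrow> (nat \<Rightarrow> 'k::field) set set \<Rightarrow> 'k mpoly set" where
  "hom_ideal n Y = genideal (poly_ring {0..n})
     {f \<in> polys {0..n}. homogeneous f \<and> (\<forall>P\<in>Y. vanishes_at f P)}"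

definition proj_toric_ideal :: "nat \<Rightarrow> (nat \<Rightarrow> nat ^ 'd) \<Rightarrow> 'k::field mpoly set" where
  "proj_toric_ideal n m = hom_ideal n (proj_closure n (toric_variety n m))"


section \<open>Term orders and Groebner bases\<close>

text \<open>\<open>(u, v) \<in> r\<close> means that \<open>u\<close> is smaller than or equal to \<open>v\<close>.\<close>

definition term_order :: "nat set \<Rightarrow> mono rel \<Rightarrow> bool" where
  "term_order X r \<longleftrightarrow> linear_order_on (monomials X) r \<and>
     (\<forall>t\<in>monomials X. (0, t) \<in> r) \<and>
     (\<forall>(u, v)\<in>r. \<forall>w\<in>monomials X. (u + w, v + w) \<in> r)"

definition smallest_var :: "nat set \<Rightarrow> mono rel \<Rightarrow> nat \<Rightarrow> bool" where
  "smallest_var X r i \<longleftrightarrow>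
     i \<in> X \<and> (\<forall>j\<in>X. (Poly_Mapping.single i 1, Poly_Mapping.single j 1) \<in> r)"

definition biggest_var :: "nat set \<Rightarrow> mono rel \<Rightarrow> nat \<Rightarrow> bool" where
  "biggest_var X r i \<longleftrightarrow>
     i \<in> X \<and> (\<forall>j\<in>X. (Poly_Mapping.single j 1, Poly_Mapping.single i 1) \<in> r)"

text \<open>The stronger sense in which the (graded) reverse lexicographic orders have a smallest variable
  $x_i$: among monomials of the same degree, those with a higher power of $x_i$ are smaller.  It
  implies \<^const>\<open>smallest_var\<close>.\<close>

definition revlex_smallest_var :: "nat set \<Rightarrow> mono rel \<Rightarrow> nat \<Rightarrow> bool" where
  "revlex_smallest_var X r i \<longleftrightarrow>
     i \<in> X \<and> (\<forall>u\<in>monomials X. \<forall>v\<in>monomials X. total_degree u = total_degree v \<longrightarrow>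
       Poly_Mapping.lookup u i > Poly_Mapping.lookup v i \<longrightarrow> (u, v) \<in> r)"

definition lead_mono :: "mono rel \<Rightarrow> 'k::comm_ring_1 mpoly \<Rightarrow> mono" where
  "lead_mono r f =
     (THE t. t \<in> Poly_Mapping.keys f \<and> (\<forall>u\<in>Poly_Mapping.keys f. (u, t) \<in> r))"

definition lead_coef :: "mono rel \<Rightarrow> 'k::comm_ring_1 mpoly \<Rightarrow> 'k" where
  "lead_coef r f = Poly_Mapping.lookup f (lead_mono r f)"

text \<open>The ideal generated by the leading monomials of the nonzero elements of a set; for an ideal
  this is its initial ideal.\<close>

definition initial_ideal ::
    "nat set \<Rightarrow> mono rel \<Rightarrow> 'k::comm_ring_1 mpoly set \<Rightarrow> 'k mpoly set" where
  "initial_ideal X r A =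
     genideal (poly_ring X) {mono_poly (lead_mono r f) | f. f \<in> A \<and> f \<noteq> 0}"

definition groebner_basis ::
    "nat set \<Rightarrow> mono rel \<Rightarrow> 'k::comm_ring_1 mpoly set \<Rightarrow> 'k mpoly set \<Rightarrow> bool" where
  "groebner_basis X r I G \<longleftrightarrow>
     finite G \<and> G \<subseteq> I \<and> initial_ideal X r G = initial_ideal X r I"

definition minimal_groebner_basis ::
    "nat set \<Rightarrow> mono rel \<Rightarrow> 'k::comm_ring_1 mpoly set \<Rightarrow> 'k mpoly set \<Rightarrow> bool" where
  "minimal_groebner_basis X r I G \<longleftrightarrow> groebner_basis X r I G \<and> 0 \<notin> G \<and>
     (\<forall>g\<in>G. lead_coef r g = 1 \<and> mono_poly (lead_mono r g) \<notin> initial_ideal X r (G - {g}))"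

definition reduced_groebner_basis ::
    "nat set \<Rightarrow> mono rel \<Rightarrow> 'k::comm_ring_1 mpoly set \<Rightarrow> 'k mpoly set \<Rightarrow> bool" where
  "reduced_groebner_basis X r I G \<longleftrightarrow> groebner_basis X r I G \<and> 0 \<notin> G \<and>
     (\<forall>g\<in>G. lead_coef r g = 1 \<and>
        (\<forall>t\<in>Poly_Mapping.keys g. mono_poly t \<notin> initial_ideal X r (G - {g})))"

definition refining_order :: "nat \<Rightarrow> mono rel \<Rightarrow> mono rel \<Rightarrow> bool" where
  "refining_order n r r' \<longleftrightarrow> term_order {0..n + 1} r' \<and>
     Restr r' (monomials {0..n}) = r \<and> biggest_var {0..n + 1} r' (n + 1)"


section \<open>The binomial \<open>F\<close>\<close>

definition F_tail :: "nat \<Rightarrow> nat \<Rightarrow> (nat \<Rightarrow> nat ^ 'd) \<Rightarrow> nat ^ 'd \<Rightarrow> (nat \<Rightarrow> nat)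
    \<Rightarrow> 'k::comm_ring_1 mpoly" where
  "F_tail n l m v s = Var 0 ^ (l - delta n m v) * (\<Prod>i\<in>{1..n}. Var i ^ s i)"

definition F_poly :: "nat \<Rightarrow> nat \<Rightarrow> (nat \<Rightarrow> nat ^ 'd) \<Rightarrow> nat ^ 'd \<Rightarrow> (nat \<Rightarrow> nat)
    \<Rightarrow> 'k::comm_ring_1 mpoly" where
  "F_poly n l m v s = Var (n + 1) ^ l - F_tail n l m v s"

end

theory Submission
  imports Defs "HOL-Number_Theory.Cong"
begin

text \<open>
  Grade monomials by their total degree together with their degree in the semigroup.  The field being
  infinite, an exponential curve in the torus separates semigroup degrees, so the homogeneous ideal of
  the projective closure consists of the polynomials whose coefficients sum to 0 over every fibre
  of this grading.  Hence a monomial lies in its initial ideal iff some strictly smaller monomial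
  has the same degree.  Given two monomials of the same degree for the extended semigroup, reduce their
  exponents of the new variable below \<open>l\<close> by means of \<open>F\<close>; these exponents then agree
  because \<open>l\<close> is coprime to a component of \<open>v\<close>, and removing the new variable leaves two
  monomials of the same degree for the original semigroup.
\<close>

section \<open>Ideals of polynomial rings\<close>

text \<open>Whether \<open>G\<close> together with \<open>F\<close> is reduced hinges on the tail of
  \<open>F\<close>. The leading monomial of \<open>F\<close>, a power of \<open>x_{n+1}\<close>, is
  not divisible by the leading monomial of any element of \<open>G\<close>, since those are
  monomials other than 1 in the old variables; hence the enlarged set is a minimal Groebner basis.
  The tail, however, is a monomial in the old variables and may be divisible by a leading monomial
  of \<open>G\<close>. For the generators 1, 2, 3 with \<open>v = 3\<close> and \<open>l = 2\<close>
  the tail is \<open>x_0 x_3\<close>, and in the lexicographic order with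
  \<open>x_3 > x_2 > x_1 > x_0\<close> the monomial \<open>x_1 x_2\<close> of the same degree is
  smaller, although \<open>x_0\<close> is the smallest variable. Different minimal representations
  also compete: for \<open>v = 4\<close> the monomials \<open>x_2^2\<close> and
  \<open>x_1 x_3\<close> have the same degree, so at most one of the two tails is irreducible.
  Therefore reducedness appears as a criterion on the tail, and under the reverse lexicographic
  condition \<open>s\<close> is chosen to give the smallest tail.\<close>

lemma keys_add_nat: "Poly_Mapping.keys (t + u) = Poly_Mapping.keys t \<union> Poly_Mapping.keys (u :: mono)"
  by (auto simp: in_keys_iff lookup_add)

lemma monomials_zero [simp]: "0 \<in> monomials X"
  by (simp add: monomials_def)

lemma monomials_add_iff [simp]: "t + u \<in> monomials X \<longleftrightarrow> t \<in> monomials X \<and> u \<in> monomials X"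
  by (auto simp: monomials_def keys_add_nat)

lemma monomials_single: "i \<in> X \<Longrightarrow> Poly_Mapping.single i k \<in> monomials X"
  by (auto simp: monomials_def)

lemma monomials_mono: "X \<subseteq> Y \<Longrightarrow> monomials X \<subseteq> monomials Y"
  by (auto simp: monomials_def)

lemma monomials_lookup_eq_0: "t \<in> monomials X \<Longrightarrow> i \<notin> X \<Longrightarrow> Poly_Mapping.lookup t i = 0"
  by (auto simp: monomials_def in_keys_iff)

lemma keys_mono_poly [simp]: "Poly_Mapping.keys (mono_poly t :: 'k::comm_ring_1 mpoly) = {t}"
  by (simp add: mono_poly_def)

lemma mono_poly_add: "(mono_poly (t + u) :: 'k::comm_ring_1 mpoly) = mono_poly t * mono_poly u"
  by (simp add: mono_poly_def mult_single)

lemma polysI: "(\<And>t. t \<in> Poly_Mapping.keys f \<Longrightarrow> t \<in> monomials X) \<Longrightarrow> f \<in> polys X"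
  and polysD: "f \<in> polys X \<Longrightarrow> t \<in> Poly_Mapping.keys f \<Longrightarrow> t \<in> monomials X"
  by (auto simp: polys_def)

lemma polys_zero [simp]: "0 \<in> polys X"
  and polys_one [simp]: "1 \<in> polys X"
  by (simp_all add: polys_def)

lemma polys_uminus [simp]: "- f \<in> polys X \<longleftrightarrow> f \<in> polys X"
  by (simp add: polys_def keys_def)

lemma polys_add: "f \<in> polys X \<Longrightarrow> g \<in> polys X \<Longrightarrow> f + g \<in> polys X"
  using Poly_Mapping.keys_add[of f g] by (auto simp: polys_def)

lemma polys_diff: "f \<in> polys X \<Longrightarrow> g \<in> polys X \<Longrightarrow> f - g \<in> polys X"
  using polys_add[of f X "- g"] by simp

lemma polys_mult: "f \<in> polys X \<Longrightarrow> g \<in> polys X \<Longrightarrow> f * g \<in> polys X"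
proof (rule polysI)
  fix t assume "f \<in> polys X" "g \<in> polys X" "t \<in> Poly_Mapping.keys (f * g)"
  moreover from this obtain a b where "t = a + b" "a \<in> Poly_Mapping.keys f" "b \<in> Poly_Mapping.keys g"
    using keys_mult[of f g] by blast
  ultimately show "t \<in> monomials X" by (simp add: polysD)
qed

lemma polys_single: "t \<in> monomials X \<Longrightarrow> Poly_Mapping.single t c \<in> polys X"
  by (auto simp: polys_def)

lemma polys_mono_poly [simp]: "(mono_poly t :: 'k::comm_ring_1 mpoly) \<in> polys X \<longleftrightarrow> t \<in> monomials X"
  by (auto simp: polys_def)

lemma polys_mono: "X \<subseteq> Y \<Longrightarrow> polys X \<subseteq> polys Y"
  using monomials_mono[of X Y] by (auto intro!: polysI dest: polysD)

lemma poly_ring_simps [simp]: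
  "carrier (poly_ring X) = polys X"
  "f \<otimes>\<^bsub>poly_ring X\<^esub> g = f * g"
  "\<one>\<^bsub>poly_ring X\<^esub> = 1"
  "\<zero>\<^bsub>poly_ring X\<^esub> = 0"
  "f \<oplus>\<^bsub>poly_ring X\<^esub> g = f + g"
  by (simp_all add: poly_ring_def)

lemma cring_poly_ring: "cring (poly_ring X :: 'k::comm_ring_1 mpoly ring)"
proof (rule cringI)
  show "abelian_group (poly_ring X :: 'k mpoly ring)"
  proof (rule abelian_groupI)
    fix f :: "'k mpoly" assume "f \<in> carrier (poly_ring X)"
    then show "\<exists>g\<in>carrier (poly_ring X). g \<oplus>\<^bsub>poly_ring X\<^esub> f = \<zero>\<^bsub>poly_ring X\<^esub>"
      by (intro bexI[of _ "- f"]) simp_all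
  qed (auto intro: polys_add simp: add_ac)
  show "comm_monoid (poly_ring X :: 'k mpoly ring)"
    by (rule comm_monoidI) (auto intro: polys_mult simp: mult_ac)
qed (auto simp: algebra_simps)

lemma ring_poly_ring: "ring (poly_ring X :: 'k::comm_ring_1 mpoly ring)"
  using cring_poly_ring by (rule cring.axioms)

lemma poly_ring_idealI:
  fixes I :: "'k::comm_ring_1 mpoly set"
  assumes "I \<subseteq> polys X" "0 \<in> I" "\<And>f g. f \<in> I \<Longrightarrow> g \<in> I \<Longrightarrow> f + g \<in> I"
    and mult: "\<And>f g. f \<in> I \<Longrightarrow> g \<in> polys X \<Longrightarrow> g * f \<in> I"
  shows "ideal I (poly_ring X)"
proof (rule idealI[OF ring_poly_ring])
  interpret R: ring "poly_ring X :: 'k mpoly ring" by (rule ring_poly_ring)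
  show "subgroup I (add_monoid (poly_ring X))"
  proof (rule subgroup.intro)
    fix f assume f: "f \<in> I"
    have "- f \<in> I" using mult[OF f, of "- 1"] by simp
    moreover have "\<ominus>\<^bsub>poly_ring X\<^esub> f = - f"
      using f assms(1) by (intro R.minus_equality) auto
    ultimately show "inv\<^bsub>add_monoid (poly_ring X)\<^esub> f \<in> I"
      by (simp add: a_inv_def)
  qed (use assms in auto)
qed (use mult in \<open>auto simp: mult.commute\<close>)

lemma
  fixes I :: "'k::comm_ring_1 mpoly set"
  assumes "ideal I (poly_ring X)"
  shows poly_ideal_subset: "I \<subseteq> polys X"
    and poly_ideal_zero: "0 \<in> I"
    and poly_ideal_add: "f \<in> I \<Longrightarrow> g \<in> I \<Longrightarrow> f + g \<in> I"
    and poly_ideal_mult: "f \<in> I \<Longrightarrow> p \<in> polys X \<Longrightarrow> p * f \<in> I"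
    and poly_ideal_diff: "f \<in> I \<Longrightarrow> g \<in> I \<Longrightarrow> f - g \<in> I"
    and poly_ideal_sum: "(\<And>i. i \<in> A \<Longrightarrow> h i \<in> I) \<Longrightarrow> (\<Sum>i\<in>A. h i) \<in> I"
proof -
  interpret ideal I "poly_ring X" by fact
  show "I \<subseteq> polys X" using a_subset by simp
  show z: "0 \<in> I" using additive_subgroup.zero_closed[OF is_additive_subgroup] by simp
  show add: "f + g \<in> I" if "f \<in> I" "g \<in> I" for f g
    using additive_subgroup.a_closed[OF is_additive_subgroup that] by simp
  show mult: "p * f \<in> I" if "f \<in> I" "p \<in> polys X" for f p
    using I_l_closed[of f p] that by simp
  have um: "- f \<in> I" if "f \<in> I" for f using mult[OF that, of "- 1"] by simp
  show "f - g \<in> I" if "f \<in> I" "g \<in> I" for f g using add[OF that(1) um[OF that(2)]] by simp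
  show "(\<And>i. i \<in> A \<Longrightarrow> h i \<in> I) \<Longrightarrow> (\<Sum>i\<in>A. h i) \<in> I"
    by (induction A rule: infinite_finite_induct) (auto intro: z add)
qed

lemmas poly_genideal = ring.genideal_ideal[OF ring_poly_ring, unfolded poly_ring_simps]
lemmas poly_genideal_self = ring.genideal_self[OF ring_poly_ring, unfolded poly_ring_simps]
lemmas poly_genideal_minimal = ring.genideal_minimal[OF ring_poly_ring, unfolded poly_ring_simps]

text \<open>The polynomials all of whose monomials are divisible by some member of \<open>M\<close>
  form an ideal, \<open>?J\<close> in the proof, that contains the generators. Exponent vectors
  being added, \<open>t = u + w\<close> expresses divisibility by \<open>u\<close>.\<close>

lemma mono_poly_in_genideal_iff:
  assumes M: "M \<subseteq> monomials X"
  shows "(mono_poly t :: 'k::comm_ring_1 mpoly) \<in> genideal (poly_ring X) (mono_poly ` M) \<longleftrightarrow>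
    t \<in> monomials X \<and> (\<exists>u\<in>M. \<exists>w. t = u + w)"
proof
  let ?J = "{f \<in> polys X :: 'k mpoly set. \<forall>t\<in>Poly_Mapping.keys f. \<exists>u\<in>M. \<exists>w. t = u + w}"
  assume t: "(mono_poly t :: 'k mpoly) \<in> genideal (poly_ring X) (mono_poly ` M)"
  have "ideal ?J (poly_ring X)"
  proof (rule poly_ring_idealI)
    fix f g assume fg: "f \<in> ?J" "g \<in> ?J"
    then show "f + g \<in> ?J" using Poly_Mapping.keys_add[of f g] by (blast intro: polys_add)
  next
    fix f g :: "'k mpoly" assume f: "f \<in> ?J" and g: "g \<in> polys X"
    have "\<exists>u\<in>M. \<exists>w. t = u + w" if tk: "t \<in> Poly_Mapping.keys (g * f)" for t
    proof -
      obtain a b where ab: "t = a + b" "b \<in> Poly_Mapping.keys f"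
        using subsetD[OF keys_mult tk] by blast
      then obtain u w where "u \<in> M" "b = u + w" using f by blast
      then show ?thesis using ab by (intro bexI[of _ u] exI[of _ "a + w"]) (simp_all add: add_ac)
    qed
    then show "g * f \<in> ?J" using f g by (auto intro: polys_mult)
  qed auto
  moreover have "mono_poly ` M \<subseteq> ?J"
  proof -
    have "\<exists>u\<in>M. \<exists>w. t = u + w" if "t \<in> M" for t
      using that by (intro bexI[of _ t] exI[of _ 0]) auto
    then show ?thesis using M by auto
  qed
  ultimately have "genideal (poly_ring X) (mono_poly ` M) \<subseteq> ?J"
    by (rule poly_genideal_minimal)
  then show "t \<in> monomials X \<and> (\<exists>u\<in>M. \<exists>w. t = u + w)" using t by auto
next
  have sub: "(mono_poly ` M :: 'k mpoly set) \<subseteq> polys X" using M by auto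
  assume "t \<in> monomials X \<and> (\<exists>u\<in>M. \<exists>w. t = u + w)"
  then obtain u w where u: "u \<in> M" "t = w + u" "w \<in> monomials X"
    by (auto simp: add.commute)
  then have "(mono_poly u :: 'k mpoly) \<in> genideal (poly_ring X) (mono_poly ` M)"
    using poly_genideal_self[OF sub] by blast
  from poly_ideal_mult[OF poly_genideal[OF sub] this, of "mono_poly w"] u
  show "(mono_poly t :: 'k mpoly) \<in> genideal (poly_ring X) (mono_poly ` M)"
    by (simp add: mono_poly_add)
qed

section \<open>Ideals of polynomials with vanishing fibre sums\<close>

text \<open>A pairing that extends \<open>h\<close> linearly from monomials to polynomials.
  Evaluation at a point and the sum of the coefficients over a fibre of a grading both have this
  form, so linearity is proved once for the two.\<close>

definition weighted_sum :: "'k::comm_ring_1 mpoly \<Rightarrow> (mono \<Rightarrow> 'k) \<Rightarrow> 'k" where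
  "weighted_sum f h = (\<Sum>t\<in>Poly_Mapping.keys f. Poly_Mapping.lookup f t * h t)"

lemma weighted_sum_superset:
  "finite A \<Longrightarrow> Poly_Mapping.keys f \<subseteq> A \<Longrightarrow> weighted_sum f h = (\<Sum>t\<in>A. Poly_Mapping.lookup f t * h t)"
  unfolding weighted_sum_def
  by (rule sum.mono_neutral_left) (auto simp: in_keys_iff)

lemma weighted_sum_zero [simp]: "weighted_sum 0 h = 0"
  by (simp add: weighted_sum_def)

lemma weighted_sum_add: "weighted_sum (f + g) h = weighted_sum f h + weighted_sum g h"
proof -
  let ?A = "Poly_Mapping.keys f \<union> Poly_Mapping.keys g"
  have "weighted_sum p h = (\<Sum>t\<in>?A. Poly_Mapping.lookup p t * h t)" if "Poly_Mapping.keys p \<subseteq> ?A" for p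
    using that by (intro weighted_sum_superset) auto
  then show ?thesis
    using Poly_Mapping.keys_add[of f g] by (simp add: lookup_add distrib_right sum.distrib)
qed

lemma weighted_sum_sum: "weighted_sum (\<Sum>i\<in>A. f i) h = (\<Sum>i\<in>A. weighted_sum (f i) h)"
  by (induction A rule: infinite_finite_induct) (auto simp: weighted_sum_add)

lemma weighted_sum_single: "weighted_sum (Poly_Mapping.single t c) h = c * h t"
  by (simp add: weighted_sum_def)

lemma weighted_sum_uminus: "weighted_sum (- f) h = - weighted_sum f h"
  using weighted_sum_add[of f "- f" h] by (simp add: add_eq_0_iff)

lemma weighted_sum_diff: "weighted_sum (f - g) h = weighted_sum f h - weighted_sum g h"
  using weighted_sum_add[of f "- g" h] by (simp add: weighted_sum_uminus)

lemma weighted_sum_mono_poly: "weighted_sum (mono_poly t) h = h t"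
  by (simp add: mono_poly_def weighted_sum_single)

lemma sum_single_lookup:
  "(\<Sum>t\<in>Poly_Mapping.keys f. Poly_Mapping.single t (Poly_Mapping.lookup f t)) = f"
  by (rule poly_mapping_eqI) (auto simp: lookup_sum lookup_single when_def in_keys_iff)

lemma weighted_sum_mult_single:
  "weighted_sum (Poly_Mapping.single w c * f) h = c * weighted_sum f (\<lambda>t. h (w + t))"
proof -
  have "Poly_Mapping.single w c * f =
      (\<Sum>t\<in>Poly_Mapping.keys f. Poly_Mapping.single (w + t) (c * Poly_Mapping.lookup f t))"
    by (subst sum_single_lookup[of f, symmetric]) (simp add: sum_distrib_left mult_single)
  then have "weighted_sum (Poly_Mapping.single w c * f) h =
      (\<Sum>t\<in>Poly_Mapping.keys f. c * Poly_Mapping.lookup f t * h (w + t))"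
    by (simp add: weighted_sum_sum weighted_sum_single)
  then show ?thesis
    by (simp add: weighted_sum_def sum_distrib_left mult.assoc)
qed

text \<open>Taking for \<open>h\<close> the indicators of single degrees shows that the coefficients
  of \<open>f\<close> sum to 0 over each fibre. Equivalently, \<open>f\<close> lies in the kernel of
  the map sending a monomial to a formal symbol for its degree. Quantifying over all
  \<open>h\<close> turns multiplication into a change of test function.\<close>

definition fiber_ideal :: "nat set \<Rightarrow> (mono \<Rightarrow> 'b) \<Rightarrow> 'k::comm_ring_1 mpoly set" where
  "fiber_ideal X \<phi> = {f \<in> polys X. \<forall>h. weighted_sum f (\<lambda>t. h (\<phi> t)) = 0}"

lemma fiber_idealD: "f \<in> fiber_ideal X \<phi> \<Longrightarrow> weighted_sum f (\<lambda>t. h (\<phi> t)) = 0"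
  by (simp add: fiber_ideal_def)

text \<open>Multiplication by a monomial \<open>w\<close> replaces the test function
  \<open>h\<close> by its translate by \<open>\<phi> w\<close>, which is again a function of the
  degree.\<close>

lemma ideal_fiber_ideal:
  fixes \<phi> :: "mono \<Rightarrow> 'b::plus"
  assumes hom: "\<And>t u. \<phi> (t + u) = \<phi> t + \<phi> u"
  shows "ideal (fiber_ideal X \<phi> :: 'k::comm_ring_1 mpoly set) (poly_ring X)"
proof (rule poly_ring_idealI)
  fix f g :: "'k mpoly" assume f: "f \<in> fiber_ideal X \<phi>" and g: "g \<in> polys X"
  have "weighted_sum (g * f) (\<lambda>t. h (\<phi> t)) = 0" for h
  proof -
    have "g * f = (\<Sum>w\<in>Poly_Mapping.keys g. Poly_Mapping.single w (Poly_Mapping.lookup g w) * f)"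
      by (subst sum_single_lookup[of g, symmetric]) (simp add: sum_distrib_right)
    moreover have "weighted_sum f (\<lambda>t. h (\<phi> w + \<phi> t)) = 0" for w
      using f by (auto simp: fiber_ideal_def)
    ultimately show ?thesis by (simp add: weighted_sum_sum weighted_sum_mult_single hom)
  qed
  then show "g * f \<in> fiber_ideal X \<phi>"
    using f g by (auto simp: fiber_ideal_def intro: polys_mult)
qed (auto simp: fiber_ideal_def weighted_sum_add intro: polys_add)

lemma binomial_in_fiber_ideal:
  "\<lbrakk>t \<in> monomials X; u \<in> monomials X; \<phi> t = \<phi> u\<rbrakk> \<Longrightarrow>
    mono_poly t - mono_poly u \<in> fiber_ideal X \<phi>"
  by (auto simp: fiber_ideal_def weighted_sum_diff weighted_sum_mono_poly intro: polys_diff)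

text \<open>Replace each monomial of \<open>f\<close> by a fixed representative of its fibre. Like
  monomials then collect with fibre sums of \<open>f\<close> as coefficients, so everything cancels,
  and \<open>f\<close> equals the combination of the binomials subtracted on the way.\<close>

lemma fiber_ideal_subset:
  fixes I :: "'k::comm_ring_1 mpoly set"
  assumes I: "ideal I (poly_ring X)"
    and bin: "\<And>t u. \<lbrakk>t \<in> monomials X; u \<in> monomials X; \<phi> t = \<phi> u\<rbrakk> \<Longrightarrow> mono_poly t - mono_poly u \<in> I"
  shows "fiber_ideal X \<phi> \<subseteq> I"
proof
  fix f :: "'k mpoly" assume f: "f \<in> fiber_ideal X \<phi>"
  have X: "t \<in> monomials X" if "t \<in> Poly_Mapping.keys f" for t
    using f that by (auto simp: fiber_ideal_def polys_def)
  define rep where "rep b = (SOME t. t \<in> Poly_Mapping.keys f \<and> \<phi> t = b)" for b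
  have rep: "rep (\<phi> t) \<in> Poly_Mapping.keys f \<and> \<phi> (rep (\<phi> t)) = \<phi> t"
    if "t \<in> Poly_Mapping.keys f" for t
    unfolding rep_def by (rule someI[of _ t]) (use that in auto)
  have zero: "(\<Sum>t\<in>Poly_Mapping.keys f. Poly_Mapping.single (rep (\<phi> t)) (Poly_Mapping.lookup f t)) = 0"
  proof (rule poly_mapping_eqI)
    fix s
    \<comment> \<open>The test function is the indicator of the degrees represented by
      \<open>s\<close>; pairing with it yields the coefficient at \<open>s\<close>.\<close>
    have "weighted_sum f (\<lambda>t. (\<lambda>b. if rep b = s then 1 else 0) (\<phi> t)) = 0"
      using f by (rule fiber_idealD)
    then show "Poly_Mapping.lookup (\<Sum>t\<in>Poly_Mapping.keys f.
        Poly_Mapping.single (rep (\<phi> t)) (Poly_Mapping.lookup f t)) s = Poly_Mapping.lookup 0 s"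
      by (simp add: weighted_sum_def lookup_sum lookup_single when_def if_distrib cong: if_cong)
  qed
  have "f = (\<Sum>t\<in>Poly_Mapping.keys f. Poly_Mapping.single t (Poly_Mapping.lookup f t))
        - (\<Sum>t\<in>Poly_Mapping.keys f. Poly_Mapping.single (rep (\<phi> t)) (Poly_Mapping.lookup f t))"
    unfolding zero by (simp add: sum_single_lookup)
  also have "\<dots> = (\<Sum>t\<in>Poly_Mapping.keys f. Poly_Mapping.single 0 (Poly_Mapping.lookup f t)
      * (mono_poly t - mono_poly (rep (\<phi> t))))"
    by (simp add: mono_poly_def right_diff_distrib mult_single sum_subtractf)
  also have "\<dots> \<in> I"
    by (intro poly_ideal_sum[OF I] poly_ideal_mult[OF I] bin polys_single)
      (use rep X in auto)
  finally show "f \<in> I" .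
qed

text \<open>A monomial alone in its fibre would make the fibre sum equal to its nonzero coefficient.
  Applied to a leading monomial, this yields a strictly smaller monomial of the same degree.\<close>

lemma fiber_ideal_other_key:
  assumes f: "f \<in> fiber_ideal X \<phi>" and t: "t \<in> Poly_Mapping.keys f"
  obtains u where "u \<in> Poly_Mapping.keys f" "u \<noteq> t" "\<phi> u = \<phi> t"
proof (rule ccontr)
  assume no: "\<not> thesis"
  have "weighted_sum f (\<lambda>u. (\<lambda>b. if b = \<phi> t then 1 else 0) (\<phi> u)) = 0"
    using f by (rule fiber_idealD)
  moreover have "weighted_sum f (\<lambda>u. (\<lambda>b. if b = \<phi> t then 1 else 0) (\<phi> u)) =
      (\<Sum>u\<in>Poly_Mapping.keys f. if u = t then Poly_Mapping.lookup f u else 0)"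
    unfolding weighted_sum_def by (rule sum.cong) (use no that in auto)
  ultimately show False using t by (simp add: in_keys_iff)
qed

section \<open>Total degree, semigroup degree and removal of a variable\<close>

lemma lookup_add_fun: "Poly_Mapping.lookup (t + u) = (\<lambda>i. Poly_Mapping.lookup t i + Poly_Mapping.lookup u i)"
  by (rule ext) (rule lookup_add)

lemma total_degree_eq_sum:
  "\<lbrakk>t \<in> monomials X; finite X\<rbrakk> \<Longrightarrow> total_degree t = (\<Sum>i\<in>X. Poly_Mapping.lookup t i)"
  unfolding total_degree_def
  by (rule sum.mono_neutral_left) (auto simp: monomials_def in_keys_iff)

lemma total_degree_add: "total_degree (t + u) = total_degree t + total_degree u"
proof -
  let ?X = "Poly_Mapping.keys t \<union> Poly_Mapping.keys u"
  have "t \<in> monomials ?X" "u \<in> monomials ?X" by (auto simp: monomials_def)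
  then show ?thesis
    by (simp add: total_degree_eq_sum[where X = ?X] lookup_add_fun sum.distrib)
qed

lemma total_degree_single [simp]: "total_degree (Poly_Mapping.single i k) = k"
  by (cases "k = 0") (simp_all add: total_degree_def)

lemma comb_add: "comb n m (\<lambda>i. s i + t i) = comb n m s + comb n m t"
  by (simp add: comb_def vec_eq_iff distrib_right sum.distrib)

text \<open>Substitutes 1 for one variable. With \<open>i = 0\<close> this dehomogenizes a monomial;
  with \<open>i = n + 1\<close> it removes the variable of the adjoined generator.\<close>

definition drop_var :: "nat \<Rightarrow> mono \<Rightarrow> mono" where
  "drop_var i t = t - Poly_Mapping.single i (Poly_Mapping.lookup t i)"

lemma lookup_drop_var: "Poly_Mapping.lookup (drop_var i t) j = (if j = i then 0 else Poly_Mapping.lookup t j)"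
  by (simp add: drop_var_def lookup_minus lookup_single when_def)

lemma drop_var_add_single: "drop_var i t + Poly_Mapping.single i (Poly_Mapping.lookup t i) = t"
  by (rule poly_mapping_eqI) (simp add: lookup_add lookup_drop_var lookup_single when_def)

lemma drop_var_add: "drop_var i (t + u) = drop_var i t + drop_var i u"
  by (rule poly_mapping_eqI) (simp add: lookup_drop_var lookup_add)

lemma drop_var_monomials: "t \<in> monomials X \<Longrightarrow> drop_var i t \<in> monomials (X - {i})"
  by (auto simp: monomials_def in_keys_iff lookup_drop_var split: if_splits)

text \<open>The sum in \<open>comb\<close> starts at 1, so \<open>x_0\<close> has degree (1, 0),
  while \<open>x_i\<close> has degree (1, \<open>m i\<close>) for \<open>i\<close> from 1 to
  \<open>n\<close>: these are the generators of the semigroup of the projective closure.\<close>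

definition hom_grading :: "nat \<Rightarrow> (nat \<Rightarrow> nat ^ 'd) \<Rightarrow> mono \<Rightarrow> nat \<times> (nat ^ 'd)" where
  "hom_grading n m t = (total_degree t, comb n m (Poly_Mapping.lookup t))"

lemma hom_grading_add: "hom_grading n m (t + u) = hom_grading n m t + hom_grading n m u"
  by (simp add: hom_grading_def total_degree_add lookup_add_fun comb_add)

section \<open>Evaluation of polynomials and the toric ideal\<close>

lemma weighted_sum_cong:
  "(\<And>t. t \<in> Poly_Mapping.keys f \<Longrightarrow> h t = h' t) \<Longrightarrow> weighted_sum f h = weighted_sum f h'"
  unfolding weighted_sum_def by (rule sum.cong) auto

lemma eval_eq_weighted_sum:
  assumes "f \<in> polys X" "finite X"
  shows "eval f a = weighted_sum f (\<lambda>t. \<Prod>i\<in>X. a i ^ Poly_Mapping.lookup t i)"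
proof -
  have "eval f a = weighted_sum f (\<lambda>t. \<Prod>i\<in>Poly_Mapping.keys t. a i ^ Poly_Mapping.lookup t i)"
    by (simp add: eval_def weighted_sum_def)
  also have "\<dots> = weighted_sum f (\<lambda>t. \<Prod>i\<in>X. a i ^ Poly_Mapping.lookup t i)"
  proof (rule weighted_sum_cong)
    fix t assume "t \<in> Poly_Mapping.keys f"
    then have "t \<in> monomials X" using assms(1) by (rule polysD[rotated])
    then show "(\<Prod>i\<in>Poly_Mapping.keys t. a i ^ Poly_Mapping.lookup t i) =
        (\<Prod>i\<in>X. a i ^ Poly_Mapping.lookup t i)"
      using assms(2) by (intro prod.mono_neutral_left) (auto simp: monomials_def in_keys_iff)
  qed
  finally show ?thesis .
qed

lemma toric_ideal_subset:
  "(toric_ideal n m :: 'k::comm_ring_1 mpoly set) \<subseteq> fiber_ideal {1..n} (\<lambda>t. comb n m (Poly_Mapping.lookup t))"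
  unfolding toric_ideal_def
  by (rule poly_genideal_minimal, rule ideal_fiber_ideal)
    (auto simp: lookup_add_fun comb_add intro: binomial_in_fiber_ideal)

lemma toric_variety_monomial_eq:
  assumes a: "a \<in> toric_variety n m" and tu: "t \<in> monomials {1..n}" "u \<in> monomials {1..n}"
    "comb n m (Poly_Mapping.lookup t) = comb n m (Poly_Mapping.lookup u)"
  shows "(\<Prod>i\<in>{1..n}. a i ^ Poly_Mapping.lookup t i) = (\<Prod>i\<in>{1..n}. (a i :: 'k::comm_ring_1) ^ Poly_Mapping.lookup u i)"
proof -
  have "mono_poly t - mono_poly u \<in> (toric_ideal n m :: 'k mpoly set)"
    unfolding toric_ideal_def
    by (rule subsetD[OF poly_genideal_self]) (use tu in \<open>auto intro!: polys_diff\<close>)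
  then have "eval (mono_poly t - mono_poly u) a = 0"
    using a by (simp add: toric_variety_def)
  moreover have "mono_poly t - mono_poly u \<in> (polys {1..n} :: 'k mpoly set)"
    using tu by (intro polys_diff) simp_all
  ultimately show ?thesis
    by (simp add: eval_eq_weighted_sum[of _ "{1..n}"] weighted_sum_diff weighted_sum_mono_poly)
qed

section \<open>Separating the points of the semigroup by a curve in the torus\<close>

text \<open>On the curve with coordinates \<open>x ^ c j\<close>, a monomial of semigroup degree
  \<open>w\<close> takes the value \<open>x ^ weight c w\<close>.\<close>

definition weight :: "('d::finite \<Rightarrow> nat) \<Rightarrow> nat ^ 'd \<Rightarrow> nat" where
  "weight c w = (\<Sum>j\<in>UNIV. c j * w $ j)"

lemma weight_comb: "weight c (comb n m s) = (\<Sum>i\<in>{1..n}. s i * weight c (m i))"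
  unfolding weight_def comb_def
  by (simp add: sum_distrib_left mult.left_commute) (rule sum.swap)

text \<open>Positional notation: coordinates are added one at a time, and the coefficient
  \<open>B\<close> of a new one exceeds all weights obtained so far on \<open>W\<close>. The old
  weight is then the remainder modulo \<open>B\<close> and the new coordinate the quotient, so both
  can be recovered.\<close>

lemma ex_separating_weight:
  assumes W: "finite (W :: (nat ^ 'd) set)"
  shows "\<exists>c. inj_on (weight c) W"
proof -
  have "\<exists>c :: 'd \<Rightarrow> nat. \<forall>w\<in>W. \<forall>w'\<in>W. (\<Sum>j\<in>D. c j * w $ j) = (\<Sum>j\<in>D. c j * w' $ j) \<longrightarrow>
      (\<forall>j\<in>D. w $ j = w' $ j)" if "finite D" for D
    using that
  proof (induction D rule: finite_induct)
    case (insert k D)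
    then obtain c :: "'d \<Rightarrow> nat" where c: "\<forall>w\<in>W. \<forall>w'\<in>W.
        (\<Sum>j\<in>D. c j * w $ j) = (\<Sum>j\<in>D. c j * w' $ j) \<longrightarrow> (\<forall>j\<in>D. w $ j = w' $ j)" by blast
    define S where "S w = (\<Sum>j\<in>D. c j * w $ j)" for w :: "nat ^ 'd"
    \<comment> \<open>The sum over \<open>W\<close> dominates every single \<open>S w\<close>, and
      \<open>Suc\<close> makes the bound strict and \<open>B\<close> positive.\<close>
    define B where "B = Suc (\<Sum>w\<in>W. S w)"
    have B: "S w < B" if "w \<in> W" for w
      unfolding B_def using member_le_sum[OF that, of S] W by simp
    let ?c = "c(k := B)"
    have sum: "(\<Sum>j\<in>insert k D. ?c j * w $ j) = S w + B * w $ k" for w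
    proof -
      have "(\<Sum>j\<in>D. ?c j * w $ j) = S w"
        unfolding S_def using insert.hyps by (intro sum.cong) auto
      then show ?thesis using insert.hyps by simp
    qed
    show ?case
    proof (intro exI[of _ ?c] ballI impI)
      fix w w' j
      assume w: "w \<in> W" "w' \<in> W" and j: "j \<in> insert k D"
        and eq: "(\<Sum>j\<in>insert k D. ?c j * w $ j) = (\<Sum>j\<in>insert k D. ?c j * w' $ j)"
      have eq': "S w + B * w $ k = S w' + B * w' $ k" using eq by (simp only: sum)
      then have "(S w + B * w $ k) mod B = (S w' + B * w' $ k) mod B" by simp
      then have S: "S w = S w'" using B w by simp
      then have "B * w $ k = B * w' $ k" using eq' by simp
      moreover have "B > 0" by (simp add: B_def)
      ultimately have "w $ k = w' $ k" by simp
      then show "w $ j = w' $ j" using c S w j unfolding S_def by blast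
    qed
  qed simp
  from this[of UNIV] show ?thesis
    by (auto simp: inj_on_def weight_def vec_eq_iff)
qed

text \<open>As in Euclid's argument: over a finite field, adding 1 to the product of all
  \<open>X - a\<close> gives a nonconstant polynomial without a root.\<close>

lemma infinite_UNIV_alg_closed: "infinite (UNIV :: 'k::alg_closed_field set)"
proof
  assume fin: "finite (UNIV :: 'k set)"
  define p :: "'k poly" where "p = (\<Prod>a\<in>UNIV. [:- a, 1:])"
  have "degree p = card (UNIV :: 'k set)"
    unfolding p_def by (subst degree_prod_sum_eq) auto
  then have "degree (p + 1) > 0"
    using fin by (subst degree_add_eq_left) (auto simp: card_gt_0_iff)
  then obtain x where "poly (p + 1) x = 0" using alg_closed_imp_poly_has_root by blast
  moreover have "poly p x = 0" using fin by (auto simp: p_def poly_prod)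
  ultimately show False by simp
qed

lemma prod_torus_point:
  "(\<Prod>i\<in>{1..n}. (\<lambda>i\<in>{1..n}. x ^ weight c (m i)) i ^ s i) = (x :: 'k::comm_ring_1) ^ weight c (comb n m s)"
proof -
  have "(\<Prod>i\<in>{1..n}. (\<lambda>i\<in>{1..n}. x ^ weight c (m i)) i ^ s i) = (\<Prod>i\<in>{1..n}. x ^ (s i * weight c (m i)))"
    by (rule prod.cong) (auto simp: power_mult[symmetric] mult.commute)
  then show ?thesis by (simp only: weight_comb power_sum)
qed

text \<open>At this point the value of a monomial depends only on its semigroup degree, so a
  polynomial with vanishing fibre sums vanishes there, also for \<open>x = 0\<close>.\<close>

lemma torus_point_in_toric_variety:
  "(\<lambda>i\<in>{1..n}. x ^ weight c (m i)) \<in> (toric_variety n m :: (nat \<Rightarrow> 'k::comm_ring_1) set)"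
proof -
  let ?a = "\<lambda>i\<in>{1..n}. x ^ weight c (m i)"
  have "eval f ?a = 0" if f: "f \<in> toric_ideal n m" for f :: "'k mpoly"
  proof -
    have f': "f \<in> fiber_ideal {1..n} (\<lambda>t. comb n m (Poly_Mapping.lookup t))"
      using f toric_ideal_subset by blast
    then have "f \<in> polys {1..n}" by (simp add: fiber_ideal_def)
    then have "eval f ?a = weighted_sum f (\<lambda>t. \<Prod>i\<in>{1..n}. ?a i ^ Poly_Mapping.lookup t i)"
      by (rule eval_eq_weighted_sum) simp
    also have "\<dots> = weighted_sum f (\<lambda>t. x ^ weight c (comb n m (Poly_Mapping.lookup t)))"
      by (simp only: prod_torus_point)
    also have "\<dots> = 0"
      using fiber_idealD[OF f', of "\<lambda>w. x ^ weight c w"] by simp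
    finally show ?thesis .
  qed
  then show ?thesis by (simp add: toric_variety_def)
qed

text \<open>For a weight \<open>c\<close> that separates the finitely many degrees occurring in
  \<open>f\<close>, the fibre sums are the coefficients of a univariate polynomial that vanishes
  everywhere, hence is 0 over an infinite field. A degree \<open>w\<close> that does not occur
  contributes only zero terms.\<close>

lemma fiber_sum_eq_0:
  fixes f :: "'k::field mpoly"
  assumes inf: "infinite (UNIV :: 'k set)"
    and zero: "\<And>c x. weighted_sum f (\<lambda>t. x ^ weight c (g t)) = 0"
  shows "weighted_sum f (\<lambda>t. if g t = w then 1 else 0) = 0"
proof (cases "w \<in> g ` Poly_Mapping.keys f")
  case True
  obtain c where c: "inj_on (weight c) (g ` Poly_Mapping.keys f)"
    using ex_separating_weight[of "g ` Poly_Mapping.keys f"] by auto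
  define p where "p = (\<Sum>t\<in>Poly_Mapping.keys f. monom (Poly_Mapping.lookup f t) (weight c (g t)))"
  have "poly p x = 0" for x
    using zero[of x c] by (simp add: p_def poly_sum poly_monom weighted_sum_def)
  then have "p = 0" using poly_roots_finite[of p] inf by auto
  then have "coeff p (weight c w) = 0" by simp
  then have "weighted_sum f (\<lambda>t. if weight c (g t) = weight c w then 1 else 0) = 0"
    by (simp add: p_def coeff_sum weighted_sum_def if_distrib cong: if_cong)
  also have "weighted_sum f (\<lambda>t. if weight c (g t) = weight c w then 1 else 0) =
      weighted_sum f (\<lambda>t. if g t = w then 1 else 0)"
    using inj_on_eq_iff[OF c _ True] by (intro weighted_sum_cong) auto
  finally show ?thesis .
next
  case False
  then show ?thesis unfolding weighted_sum_def by (intro sum.neutral) auto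
qed

section \<open>The homogeneous ideal of the projective closure\<close>

definition chart_point :: "nat \<Rightarrow> (nat \<Rightarrow> 'k::field) \<Rightarrow> nat \<Rightarrow> 'k" where
  "chart_point n a = (\<lambda>i\<in>{0..n}. if i = 0 then 1 else a i)"

lemma chart_point_in_hom_coords: "chart_point n a \<in> hom_coords n"
  by (auto simp: chart_point_def hom_coords_def intro!: bexI[of _ 0])

lemma affine_chart_iff:
  "b \<in> affine_chart n a \<longleftrightarrow>
    b \<in> hom_coords n \<and> (\<exists>c. c \<noteq> 0 \<and> (\<forall>i\<in>{0..n}. b i = c * chart_point n a i))"
  using chart_point_in_hom_coords[of n a]
  by (simp add: affine_chart_def proj_rel_def chart_point_def[symmetric])

lemma chart_point_in_affine_chart: "chart_point n a \<in> affine_chart n a"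
  unfolding affine_chart_iff by (auto simp: chart_point_in_hom_coords intro: exI[of _ 1])

lemma affine_chart_in_proj_space: "affine_chart n a \<in> proj_space n"
  using chart_point_in_hom_coords[of n a]
  by (simp add: affine_chart_def proj_space_def chart_point_def quotientI)

lemma prod_chart_point:
  "(\<Prod>i\<in>{0..n}. chart_point n a i ^ Poly_Mapping.lookup t i) = (\<Prod>i\<in>{1..n}. a i ^ Poly_Mapping.lookup t i)"
proof -
  have "(\<Prod>i\<in>{0..n}. chart_point n a i ^ Poly_Mapping.lookup t i) =
      chart_point n a 0 ^ Poly_Mapping.lookup t 0 *
      (\<Prod>i\<in>{1..n}. chart_point n a i ^ Poly_Mapping.lookup t i)"
    by (simp add: prod.atLeast_Suc_atMost)
  also have "\<dots> = (\<Prod>i\<in>{1..n}. a i ^ Poly_Mapping.lookup t i)"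
    by (auto simp: chart_point_def intro!: prod.cong)
  finally show ?thesis .
qed

lemma homogeneous_binomial:
  assumes "total_degree t = total_degree u"
  shows "homogeneous (mono_poly t - mono_poly u :: 'k::comm_ring_1 mpoly)"
proof -
  have "Poly_Mapping.keys (mono_poly t - mono_poly u :: 'k mpoly) \<subseteq> {t, u}"
    by (auto simp: in_keys_iff mono_poly_def lookup_minus lookup_single when_def split: if_splits)
  then show ?thesis using assms by (fastforce simp: homogeneous_def)
qed

text \<open>At \<open>c\<close> times the chart point a monomial takes the value \<open>c\<close> to
  its total degree times the value at \<open>a\<close> of its part in \<open>x_1, ..., x_n\<close>.
  Equality of \<open>hom_grading\<close> makes both factors agree for \<open>t\<close> and
  \<open>u\<close>.\<close>

lemma binomial_vanishes_on_affine_chart: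
  fixes a :: "nat \<Rightarrow> 'k::field"
  assumes a: "a \<in> toric_variety n m"
    and tu: "t \<in> monomials {0..n}" "u \<in> monomials {0..n}" "hom_grading n m t = hom_grading n m u"
  shows "vanishes_at (mono_poly t - mono_poly u) (affine_chart n a)"
  unfolding vanishes_at_def
proof
  fix b assume "b \<in> affine_chart n a"
  then obtain c where c: "\<And>i. i \<in> {0..n} \<Longrightarrow> b i = c * chart_point n a i"
    unfolding affine_chart_iff by blast
  have eval: "eval (mono_poly s) b = c ^ total_degree s * (\<Prod>i\<in>{1..n}. a i ^ Poly_Mapping.lookup s i)"
    if s: "s \<in> monomials {0..n}" for s
  proof -
    have "eval (mono_poly s) b = (\<Prod>i\<in>{0..n}. b i ^ Poly_Mapping.lookup s i)"
      using s by (subst eval_eq_weighted_sum[of _ "{0..n}"]) (auto simp: weighted_sum_mono_poly)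
    also have "\<dots> = (\<Prod>i\<in>{0..n}. c ^ Poly_Mapping.lookup s i * chart_point n a i ^ Poly_Mapping.lookup s i)"
      by (intro prod.cong) (auto simp: c power_mult_distrib)
    also have "\<dots> = c ^ total_degree s * (\<Prod>i\<in>{1..n}. a i ^ Poly_Mapping.lookup s i)"
      by (simp only: prod.distrib prod_chart_point total_degree_eq_sum[OF s finite_atLeastAtMost]
          power_sum)
    finally show ?thesis .
  qed
  \<comment> \<open>The binomials of the toric ideal involve only \<open>x_1, ..., x_n\<close>, so
    \<open>x_0\<close> is removed before they are used; this changes neither the semigroup degree
    nor the affine value.\<close>
  have drop: "drop_var 0 s \<in> monomials {1..n}" if "s \<in> monomials {0..n}" for s
    using drop_var_monomials[OF that, of 0] by (simp add: atLeastAtMost_insertL[symmetric] monomials_def)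
  have comb: "comb n m (Poly_Mapping.lookup (drop_var 0 s)) = comb n m (Poly_Mapping.lookup s)" for s
    unfolding comb_def by (rule sum.cong) (auto simp: lookup_drop_var)
  have prod: "(\<Prod>i\<in>{1..n}. a i ^ Poly_Mapping.lookup (drop_var 0 s) i) =
      (\<Prod>i\<in>{1..n}. a i ^ Poly_Mapping.lookup s i)" for s
    by (rule prod.cong) (auto simp: lookup_drop_var)
  have "(\<Prod>i\<in>{1..n}. a i ^ Poly_Mapping.lookup t i) = (\<Prod>i\<in>{1..n}. a i ^ Poly_Mapping.lookup u i)"
    using toric_variety_monomial_eq[OF a drop[OF tu(1)] drop[OF tu(2)]] tu(3)
    unfolding comb prod hom_grading_def by simp
  moreover have "eval (mono_poly t - mono_poly u) b = eval (mono_poly t) b - eval (mono_poly u) b"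
    using tu by (simp add: eval_eq_weighted_sum[of _ "{0..n}"] polys_diff weighted_sum_diff)
  ultimately show "eval (mono_poly t - mono_poly u) b = 0"
    using tu by (simp add: eval hom_grading_def)
qed

text \<open>The zero set of one homogeneous binomial is closed and contains the image of the toric
  variety, hence the closure; the points at infinity never have to be described.\<close>

lemma binomial_vanishes_on_proj_closure:
  fixes m :: "nat \<Rightarrow> nat ^ 'd"
  assumes tu: "t \<in> monomials {0..n}" "u \<in> monomials {0..n}" "hom_grading n m t = hom_grading n m u"
    and P: "P \<in> proj_closure n (toric_variety n m :: (nat \<Rightarrow> 'k::field) set)"
  shows "vanishes_at (mono_poly t - mono_poly u) P"
proof -
  let ?f = "mono_poly t - mono_poly u :: 'k mpoly"
  let ?Z = "{P \<in> proj_space n. \<forall>f\<in>{?f}. vanishes_at f P}"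
  have "?f \<in> polys {0..n}" "homogeneous ?f"
    using tu by (auto intro: polys_diff homogeneous_binomial simp: hom_grading_def)
  then have "proj_closed n ?Z"
    unfolding proj_closed_def by (intro exI[of _ "{?f}"]) auto
  moreover have "affine_chart n ` toric_variety n m \<subseteq> ?Z"
    using binomial_vanishes_on_affine_chart[OF _ tu] affine_chart_in_proj_space by auto
  ultimately have "proj_closure n (toric_variety n m) \<subseteq> ?Z"
    unfolding proj_closure_def by (intro hull_minimal)
  then show ?thesis using P by auto
qed

text \<open>Evaluating \<open>f\<close> along the curves controls only the sums over fibres of the
  semigroup degree. Homogeneity closes the gap: the total degree is a constant \<open>e\<close> on
  the monomials of \<open>f\<close>, so among them these fibres are those of
  \<open>hom_grading\<close>.\<close>

lemma vanishing_in_fiber_ideal: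
  fixes m :: "nat \<Rightarrow> nat ^ 'd" and f :: "'k::alg_closed_field mpoly"
  assumes f: "f \<in> polys {0..n}" "homogeneous f"
    and van: "\<And>P. P \<in> proj_closure n (toric_variety n m) \<Longrightarrow> vanishes_at f P"
  shows "f \<in> fiber_ideal {0..n} (hom_grading n m)"
proof -
  let ?g = "\<lambda>t. comb n m (Poly_Mapping.lookup t)" and ?K = "Poly_Mapping.keys f"
  have zero: "weighted_sum f (\<lambda>t. x ^ weight c (?g t)) = 0" for x c
  proof -
    let ?a = "\<lambda>i\<in>{1..n}. x ^ weight c (m i)"
    have "affine_chart n ?a \<in> proj_closure n (toric_variety n m)"
      unfolding proj_closure_def by (intro hull_inc imageI torus_point_in_toric_variety)
    then have "eval f (chart_point n ?a) = 0"
      using van chart_point_in_affine_chart by (auto simp: vanishes_at_def)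
    then have "weighted_sum f (\<lambda>t. \<Prod>i\<in>{1..n}. ?a i ^ Poly_Mapping.lookup t i) = 0"
      using eval_eq_weighted_sum[OF f(1), of "chart_point n ?a"] by (simp add: prod_chart_point)
    then show ?thesis by (simp only: prod_torus_point)
  qed
  obtain e where e: "\<And>t. t \<in> ?K \<Longrightarrow> total_degree t = e"
    using f(2) by (auto simp: homogeneous_def)
  have "weighted_sum f (\<lambda>t. h (hom_grading n m t)) = 0" for h :: "nat \<times> (nat ^ 'd) \<Rightarrow> 'k"
  proof -
    have fiber: "(\<Sum>t | t \<in> ?K \<and> ?g t = w. Poly_Mapping.lookup f t) = 0" for w
    proof -
      have "weighted_sum f (\<lambda>t. if ?g t = w then 1 else 0) = 0"
        by (rule fiber_sum_eq_0[OF infinite_UNIV_alg_closed zero])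
      then show ?thesis
        by (simp add: weighted_sum_def if_distrib sum.inter_filter cong: if_cong)
    qed
    have "weighted_sum f (\<lambda>t. h (hom_grading n m t)) = (\<Sum>t\<in>?K. Poly_Mapping.lookup f t * h (e, ?g t))"
      unfolding weighted_sum_def by (rule sum.cong) (auto simp: hom_grading_def e)
    also have "\<dots> = (\<Sum>w\<in>?g ` ?K. \<Sum>t | t \<in> ?K \<and> ?g t = w. Poly_Mapping.lookup f t * h (e, ?g t))"
      by (rule sum.image_gen) simp
    also have "\<dots> = (\<Sum>w\<in>?g ` ?K. (\<Sum>t | t \<in> ?K \<and> ?g t = w. Poly_Mapping.lookup f t) * h (e, w))"
      by (intro sum.cong) (auto simp: sum_distrib_right)
    also have "\<dots> = 0" by (simp add: fiber)
    finally show ?thesis .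
  qed
  then show ?thesis using f by (simp add: fiber_ideal_def)
qed

text \<open>The homogeneous polynomials generating the left side have vanishing fibre sums;
  conversely the fibre ideal is generated by homogeneous binomials, which vanish on the closure.
  From here on the argument concerns monomials and their degrees only.\<close>

theorem proj_toric_ideal_eq_fiber_ideal:
  fixes m :: "nat \<Rightarrow> nat ^ 'd"
  shows "(proj_toric_ideal n m :: 'k::alg_closed_field mpoly set) = fiber_ideal {0..n} (hom_grading n m)"
proof
  show "(proj_toric_ideal n m :: 'k mpoly set) \<subseteq> fiber_ideal {0..n} (hom_grading n m)"
    unfolding proj_toric_ideal_def hom_ideal_def
    by (intro poly_genideal_minimal ideal_fiber_ideal hom_grading_add)
      (auto intro: vanishing_in_fiber_ideal)
  show "fiber_ideal {0..n} (hom_grading n m) \<subseteq> (proj_toric_ideal n m :: 'k mpoly set)"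
  proof (rule fiber_ideal_subset)
    show "ideal (proj_toric_ideal n m :: 'k mpoly set) (poly_ring {0..n})"
      unfolding proj_toric_ideal_def hom_ideal_def by (rule poly_genideal) auto
  next
    fix t u assume tu: "t \<in> monomials {0..n}" "u \<in> monomials {0..n}"
      "hom_grading n m t = hom_grading n m u"
    show "mono_poly t - mono_poly u \<in> (proj_toric_ideal n m :: 'k mpoly set)"
      unfolding proj_toric_ideal_def hom_ideal_def
      by (rule subsetD[OF poly_genideal_self])
        (use tu in \<open>auto intro: polys_diff homogeneous_binomial binomial_vanishes_on_proj_closure
          simp: hom_grading_def\<close>)
  qed
qed

section \<open>Term orders and initial ideals\<close>

lemma
  assumes "term_order X r"
  shows term_order_subset: "(t, u) \<in> r \<Longrightarrow> t \<in> monomials X \<and> u \<in> monomials X"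
    and term_order_refl: "t \<in> monomials X \<Longrightarrow> (t, t) \<in> r"
    and term_order_trans: "(t, u) \<in> r \<Longrightarrow> (u, w) \<in> r \<Longrightarrow> (t, w) \<in> r"
    and term_order_antisym: "(t, u) \<in> r \<Longrightarrow> (u, t) \<in> r \<Longrightarrow> t = u"
    and term_order_total: "t \<in> monomials X \<Longrightarrow> u \<in> monomials X \<Longrightarrow> (t, u) \<in> r \<or> (u, t) \<in> r"
    and term_order_zero: "t \<in> monomials X \<Longrightarrow> (0, t) \<in> r"
    and term_order_add: "(t, u) \<in> r \<Longrightarrow> w \<in> monomials X \<Longrightarrow> (t + w, u + w) \<in> r"
proof -
  have lin: "r \<subseteq> monomials X \<times> monomials X" "refl_on (monomials X) r" "trans r" "antisym r"
      "total_on (monomials X) r"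
    using assms by (auto simp: term_order_def order_on_defs)
  show "(t, u) \<in> r \<Longrightarrow> t \<in> monomials X \<and> u \<in> monomials X" using lin by auto
  show refl: "t \<in> monomials X \<Longrightarrow> (t, t) \<in> r" for t using lin by (auto simp: refl_on_def)
  show "(t, u) \<in> r \<Longrightarrow> (u, w) \<in> r \<Longrightarrow> (t, w) \<in> r" using lin by (auto dest: transD)
  show "(t, u) \<in> r \<Longrightarrow> (u, t) \<in> r \<Longrightarrow> t = u" using lin by (auto dest: antisymD)
  show "t \<in> monomials X \<Longrightarrow> u \<in> monomials X \<Longrightarrow> (t, u) \<in> r \<or> (u, t) \<in> r"
    using lin refl by (cases "t = u") (auto simp: total_on_def)
qed (use assms in \<open>auto simp: term_order_def\<close>)

lemma term_order_add_cancel: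
  assumes r: "term_order X r" and mon: "t \<in> monomials X" "u \<in> monomials X"
    and le: "(t + w, u + w) \<in> r"
  shows "(t, u) \<in> r"
proof (rule ccontr)
  assume no: "(t, u) \<notin> r"
  then have ut: "(u, t) \<in> r" using term_order_total[OF r mon] by blast
  have "w \<in> monomials X" using term_order_subset[OF r le] by simp
  from term_order_antisym[OF r le term_order_add[OF r ut this]] no ut show False by simp
qed

text \<open>Stated for linear orders in general, so that the converse relation gives least elements
  too.\<close>

lemma linear_order_on_ex_max:
  assumes r: "linear_order_on A r" and "finite K" "K \<noteq> {}" "K \<subseteq> A"
  shows "\<exists>t\<in>K. \<forall>u\<in>K. (u, t) \<in> r"
  using assms(2-)
proof (induction K rule: finite_ne_induct)
  case (singleton x)
  then show ?case using r by (auto simp: order_on_defs refl_on_def)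
next
  case (insert x K)
  then obtain t where t: "t \<in> K" "\<And>u. u \<in> K \<Longrightarrow> (u, t) \<in> r" by auto
  have refl: "(x, x) \<in> r" using r insert.prems by (auto simp: order_on_defs refl_on_def)
  show ?case
  proof (cases "(x, t) \<in> r")
    case True
    then show ?thesis using t by auto
  next
    case False
    have "total_on A r" and trans: "trans r" using r by (simp_all add: order_on_defs)
    moreover have "x \<in> A" "t \<in> A" "x \<noteq> t" using insert.prems insert.hyps t(1) by auto
    ultimately have "(t, x) \<in> r" using False by (auto simp: total_on_def)
    then have "(u, x) \<in> r" if "u \<in> K" for u
      using transD[OF trans t(2)[OF that]] by blast
    then show ?thesis using refl by auto
  qed
qed

lemma lead_mono_eqI:
  assumes "term_order X r" "t \<in> Poly_Mapping.keys f" "\<And>u. u \<in> Poly_Mapping.keys f \<Longrightarrow> (u, t) \<in> r"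
  shows "lead_mono r f = t"
  unfolding lead_mono_def
  by (rule the_equality) (use assms term_order_antisym[OF assms(1)] in auto)

lemma
  assumes r: "term_order X r" and f: "f \<in> polys X" "f \<noteq> 0"
  shows lead_mono_in_keys: "lead_mono r f \<in> Poly_Mapping.keys f"
    and lead_mono_ge: "u \<in> Poly_Mapping.keys f \<Longrightarrow> (u, lead_mono r f) \<in> r"
    and lead_mono_in_monomials: "lead_mono r f \<in> monomials X"
proof -
  have "Poly_Mapping.keys f \<noteq> {}" using f(2) by simp
  moreover have "Poly_Mapping.keys f \<subseteq> monomials X" using f(1) by (simp add: polys_def)
  ultimately obtain t where t: "t \<in> Poly_Mapping.keys f" "\<And>u. u \<in> Poly_Mapping.keys f \<Longrightarrow> (u, t) \<in> r"
    using linear_order_on_ex_max[of "monomials X" r "Poly_Mapping.keys f"] r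
    by (auto simp: term_order_def)
  then have "lead_mono r f = t" by (rule lead_mono_eqI[OF r])
  then show "lead_mono r f \<in> Poly_Mapping.keys f"
    "u \<in> Poly_Mapping.keys f \<Longrightarrow> (u, lead_mono r f) \<in> r" "lead_mono r f \<in> monomials X"
    using t polysD[OF f(1)] by auto
qed

lemma keys_binomial:
  "t \<noteq> u \<Longrightarrow> Poly_Mapping.keys (mono_poly t - mono_poly u :: 'k::comm_ring_1 mpoly) = {t, u}"
  by (auto simp: in_keys_iff mono_poly_def lookup_minus lookup_single when_def split: if_splits)

lemma lead_mono_binomial:
  assumes "term_order X r" "(u, t) \<in> r" "u \<noteq> t"
  shows "lead_mono r (mono_poly t - mono_poly u :: 'k::comm_ring_1 mpoly) = t"
proof (rule lead_mono_eqI[OF assms(1)])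
  have "(t, t) \<in> r"
    using term_order_refl[OF assms(1)] term_order_subset[OF assms(1,2)] by blast
  then show "(w, t) \<in> r" if "w \<in> Poly_Mapping.keys (mono_poly t - mono_poly u :: 'k mpoly)" for w
    using that assms keys_binomial[of t u] by auto
qed (use assms keys_binomial[of t u] in auto)

lemma initial_ideal_gens_subset:
  assumes "term_order X r" "A \<subseteq> polys X"
  shows "{lead_mono r f | f. f \<in> A \<and> f \<noteq> 0} \<subseteq> monomials X"
  using lead_mono_in_monomials[OF assms(1)] assms(2) by auto

lemma initial_ideal_altdef:
  "initial_ideal X r A = genideal (poly_ring X) (mono_poly ` {lead_mono r f | f. f \<in> A \<and> f \<noteq> 0})"
  unfolding initial_ideal_def by (rule arg_cong[where f = "genideal (poly_ring X)"]) auto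

lemma mono_poly_in_initial_ideal_iff:
  assumes "term_order X r" "A \<subseteq> polys X"
  shows "(mono_poly t :: 'k::comm_ring_1 mpoly) \<in> initial_ideal X r A \<longleftrightarrow>
    t \<in> monomials X \<and> (\<exists>f\<in>A. f \<noteq> 0 \<and> (\<exists>w. t = lead_mono r f + w))"
  unfolding initial_ideal_altdef mono_poly_in_genideal_iff[OF initial_ideal_gens_subset[OF assms]]
  by auto

lemma groebner_basisI:
  fixes I :: "'k::comm_ring_1 mpoly set"
  assumes r: "term_order X r" and "finite G" "G \<subseteq> I" and I: "I \<subseteq> polys X"
    and lead: "\<And>f. f \<in> I \<Longrightarrow> f \<noteq> 0 \<Longrightarrow> mono_poly (lead_mono r f) \<in> initial_ideal X r G"
  shows "groebner_basis X r I G"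
proof -
  have sub: "(mono_poly ` {lead_mono r f | f. f \<in> A \<and> f \<noteq> 0} :: 'k mpoly set) \<subseteq> polys X"
    if "A \<subseteq> I" for A
    using initial_ideal_gens_subset[OF r order_trans[OF that I]] by auto
  have "initial_ideal X r I \<subseteq> initial_ideal X r G"
    unfolding initial_ideal_altdef[of X r I]
  proof (rule poly_genideal_minimal)
    show "ideal (initial_ideal X r G) (poly_ring X)"
      unfolding initial_ideal_altdef by (rule poly_genideal[OF sub]) fact
  qed (use lead in auto)
  moreover have "initial_ideal X r G \<subseteq> initial_ideal X r I"
    unfolding initial_ideal_altdef[of X r G]
  proof (rule poly_genideal_minimal)
    show "ideal (initial_ideal X r I) (poly_ring X)"
      unfolding initial_ideal_altdef by (rule poly_genideal[OF sub]) simp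
    show "mono_poly ` {lead_mono r f |f. f \<in> G \<and> f \<noteq> 0} \<subseteq> initial_ideal X r I"
      unfolding initial_ideal_altdef using poly_genideal_self[OF sub[OF order_refl]] assms(3) by blast
  qed
  ultimately show ?thesis using assms(2,3) by (simp add: groebner_basis_def)
qed

text \<open>Forward: the leading monomial of \<open>f\<close> shares its fibre with a smaller
  monomial of \<open>f\<close>, and multiplying both by \<open>w\<close> keeps the degrees equal and
  the order strict. Backward: \<open>t\<close> is the leading monomial of the binomial of
  \<open>t\<close> and \<open>u\<close>.\<close>

lemma mono_poly_in_initial_fiber_ideal_iff:
  assumes r: "term_order X r" and hom: "\<And>t u. \<phi> (t + u) = \<phi> t + \<phi> u"
  shows "(mono_poly t :: 'k::comm_ring_1 mpoly) \<in> initial_ideal X r (fiber_ideal X \<phi>) \<longleftrightarrow>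
    (\<exists>u. u \<noteq> t \<and> (u, t) \<in> r \<and> \<phi> u = \<phi> t)"
proof -
  have sub: "(fiber_ideal X \<phi> :: 'k mpoly set) \<subseteq> polys X" by (auto simp: fiber_ideal_def)
  show ?thesis unfolding mono_poly_in_initial_ideal_iff[OF r sub]
  proof
    assume "t \<in> monomials X \<and>
      (\<exists>f\<in>(fiber_ideal X \<phi> :: 'k mpoly set). f \<noteq> 0 \<and> (\<exists>w. t = lead_mono r f + w))"
    then obtain f :: "'k mpoly" and w where f: "f \<in> fiber_ideal X \<phi>" "f \<noteq> 0"
      and t: "t = lead_mono r f + w" "t \<in> monomials X" by auto
    have fX: "f \<in> polys X" using f sub by blast
    obtain u where u: "u \<in> Poly_Mapping.keys f" "u \<noteq> lead_mono r f" "\<phi> u = \<phi> (lead_mono r f)"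
      using fiber_ideal_other_key[OF f(1) lead_mono_in_keys[OF r fX f(2)]] by blast
    have "(u + w, lead_mono r f + w) \<in> r"
      using t by (intro term_order_add[OF r lead_mono_ge[OF r fX f(2) u(1)]]) simp
    then show "\<exists>u. u \<noteq> t \<and> (u, t) \<in> r \<and> \<phi> u = \<phi> t"
      using u t by (intro exI[of _ "u + w"]) (simp add: hom)
  next
    assume "\<exists>u. u \<noteq> t \<and> (u, t) \<in> r \<and> \<phi> u = \<phi> t"
    then obtain u where u: "u \<noteq> t" "(u, t) \<in> r" "\<phi> u = \<phi> t" by blast
    then have mon: "t \<in> monomials X" "u \<in> monomials X" using term_order_subset[OF r] by auto
    let ?f = "mono_poly t - mono_poly u :: 'k mpoly"
    have "?f \<in> fiber_ideal X \<phi>" using mon u by (intro binomial_in_fiber_ideal) auto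
    moreover have "?f \<noteq> 0" using keys_binomial[of t u] u(1) by (metis keys_zero insert_not_empty)
    moreover have "t = lead_mono r ?f + 0" by (simp add: lead_mono_binomial[OF r u(2,1)])
    ultimately show "t \<in> monomials X \<and>
      (\<exists>f\<in>(fiber_ideal X \<phi> :: 'k mpoly set). f \<noteq> 0 \<and> (\<exists>w. t = lead_mono r f + w))"
      using mon by blast
  qed
qed

text \<open>Makes the fibres of \<open>hom_grading\<close> finite, so that a least monomial of a
  given degree can be picked.\<close>

lemma finite_monomials_total_degree:
  assumes "finite X"
  shows "finite {t \<in> monomials X. total_degree t = k}"
proof -
  let ?B = "{f. \<forall>i. (i \<in> X \<longrightarrow> f i \<in> {..k}) \<and> (i \<notin> X \<longrightarrow> f i = 0)}"
  have "Poly_Mapping.lookup ` {t \<in> monomials X. total_degree t = k} \<subseteq> ?B"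
  proof (rule image_subsetI)
    fix t assume t: "t \<in> {t \<in> monomials X. total_degree t = k}"
    have "Poly_Mapping.lookup t i \<in> {..k}" if "i \<in> X" for i
      using member_le_sum[OF that _ assms, of "Poly_Mapping.lookup t"] t assms
      by (simp add: total_degree_eq_sum[symmetric])
    then show "Poly_Mapping.lookup t \<in> ?B" using t by (auto simp: monomials_lookup_eq_0)
  qed
  moreover have "finite ?B" by (rule finite_set_of_finite_funs) (use assms in auto)
  ultimately have "finite (Poly_Mapping.lookup ` {t \<in> monomials X. total_degree t = k})"
    by (rule finite_subset)
  then show ?thesis
    by (rule finite_imageD, intro inj_onI poly_mapping_eqI) simp
qed

section \<open>Refining term orders\<close>

text \<open>Exponents of \<open>x_{n+1}\<close> are compared first and ties are broken by
  \<open>r\<close> on the remaining variables: an elimination order for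
  \<open>x_{n+1}\<close>.\<close>

lemma ex_refining_order:
  assumes r: "term_order {0..n} r"
  shows "\<exists>r'. refining_order n r r'"
proof
  let ?N = "n + 1" and ?X = "monomials {0..n + 1}"
  let ?l = "\<lambda>t. Poly_Mapping.lookup t ?N" and ?d = "drop_var ?N"
  define r' where "r' = {(t, u). t \<in> ?X \<and> u \<in> ?X \<and> (?l t < ?l u \<or> ?l t = ?l u \<and> (?d t, ?d u) \<in> r)}"
  have d: "?d t \<in> monomials {0..n}" if "t \<in> ?X" for t
    using drop_var_monomials[OF that, of ?N]
    by (rule rev_subsetD) (intro monomials_mono, auto)
  have inj: "t = u" if "?l t = ?l u" "?d t = ?d u" for t u
    using that by (metis drop_var_add_single)
  have lin: "linear_order_on ?X r'"
    unfolding order_on_defs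
  proof (intro conjI)
    show "r' \<subseteq> ?X \<times> ?X" by (auto simp: r'_def)
    show "refl_on ?X r'" using term_order_refl[OF r] d by (auto simp: refl_on_def r'_def)
    show "trans r'" using term_order_trans[OF r] by (auto simp: r'_def intro!: transI)
    show "antisym r'" using term_order_antisym[OF r] inj by (auto simp: r'_def intro!: antisymI)
    show "total_on ?X r'" using term_order_total[OF r] d by (auto simp: r'_def total_on_def)
  qed
  have d0: "?d t = t" if "t \<in> monomials {0..n}" for t
    using that by (intro poly_mapping_eqI) (auto simp: lookup_drop_var monomials_lookup_eq_0)
  have sub: "monomials {0..n} \<subseteq> ?X" by (intro monomials_mono) auto
  have l0: "?l t = 0" if "t \<in> monomials {0..n}" for t
    using that by (rule monomials_lookup_eq_0) simp
  have "term_order {0..n + 1} r'"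
    unfolding term_order_def
  proof (intro conjI ballI)
    fix t assume "t \<in> ?X"
    then show "(0, t) \<in> r'" using term_order_zero[OF r d, of t] d0[of 0] by (auto simp: r'_def)
  next
    fix x assume "x \<in> r'"
    then show "case x of (u, v) \<Rightarrow> \<forall>w\<in>?X. (u + w, v + w) \<in> r'"
      using term_order_add[OF r] d by (auto simp: r'_def lookup_add drop_var_add)
  qed (rule lin)
  moreover have "Restr r' (monomials {0..n}) = r"
  proof (intro equalityI subsetI)
    fix x assume "x \<in> r"
    moreover from this have "fst x \<in> monomials {0..n}" "snd x \<in> monomials {0..n}"
      using term_order_subset[OF r, of "fst x" "snd x"] by auto
    ultimately show "x \<in> Restr r' (monomials {0..n})"
      using sub by (cases x) (auto simp: r'_def l0[simplified] d0[simplified])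
  next
    fix x assume "x \<in> Restr r' (monomials {0..n})"
    then show "x \<in> r" by (cases x) (auto simp: r'_def l0[simplified] d0[simplified])
  qed
  moreover have "biggest_var {0..n + 1} r' ?N"
    unfolding biggest_var_def
  proof (intro conjI ballI)
    fix j assume j: "j \<in> {0..n + 1}"
    have mon: "Poly_Mapping.single j 1 \<in> ?X" "Poly_Mapping.single ?N 1 \<in> ?X"
      using j by (auto intro: monomials_single)
    show "(Poly_Mapping.single j 1, Poly_Mapping.single ?N 1) \<in> r'"
    proof (cases "j = ?N")
      case True
      then show ?thesis using lin mon by (auto simp: order_on_defs refl_on_def)
    next
      case False
      then show ?thesis using mon by (auto simp: r'_def lookup_single)
    qed
  qed simp
  ultimately show "refining_order n r r'" by (simp add: refining_order_def)
qed

text \<open>Replacing the variables of \<open>t\<close> one by one by the biggest one never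
  decreases the monomial. As the tail of \<open>F\<close> has total degree \<open>l\<close>, this
  fixes the leading monomial of \<open>F\<close> for every refining order, not just for an
  elimination order.\<close>

lemma le_biggest_var_power:
  assumes r: "term_order X r" and big: "biggest_var X r k" and t: "t \<in> monomials X"
  shows "(t, Poly_Mapping.single k (total_degree t)) \<in> r"
  using t
proof (induction "total_degree t" arbitrary: t)
  case 0
  then have "t = 0" by (intro poly_mapping_eqI) (auto simp: total_degree_def in_keys_iff)
  then show ?case using term_order_refl[OF r, of 0] by (simp add: total_degree_def)
next
  case (Suc d)
  then obtain i where i: "i \<in> Poly_Mapping.keys t" by (fastforce simp: total_degree_def)
  define t0 where "t0 = t - Poly_Mapping.single i 1"
  have t: "t = t0 + Poly_Mapping.single i 1"
    unfolding t0_def using i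
    by (intro poly_mapping_eqI) (auto simp: lookup_add lookup_minus lookup_single when_def in_keys_iff)
  have d: "total_degree t = total_degree t0 + 1" by (simp add: t total_degree_add)
  have mon: "t0 \<in> monomials X" "Poly_Mapping.single i 1 \<in> monomials X" using Suc.prems t by auto
  have iX: "i \<in> X" "k \<in> X" using i Suc.prems big by (auto simp: monomials_def biggest_var_def)
  let ?s = "Poly_Mapping.single k (total_degree t0)"
  have "(t0, ?s) \<in> r" using Suc d mon by simp
  from term_order_add[OF r this mon(2)] have 1: "(t, ?s + Poly_Mapping.single i 1) \<in> r"
    by (simp add: t)
  have "(Poly_Mapping.single i 1, Poly_Mapping.single k 1) \<in> r"
    using big iX by (simp add: biggest_var_def)
  from term_order_add[OF r this, of ?s]
  have "(?s + Poly_Mapping.single i 1, ?s + Poly_Mapping.single k 1) \<in> r"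
    using iX by (simp add: monomials_single add.commute)
  from term_order_trans[OF r 1 this] show ?case by (simp add: d single_add[symmetric])
qed

section \<open>Adjoining the generator \<open>v\<close>\<close>

lemma mono_poly_zero: "mono_poly 0 = 1"
  by (simp add: mono_poly_def)

lemma Var_power: "Var i ^ k = (mono_poly (Poly_Mapping.single i k) :: 'k::comm_ring_1 mpoly)"
  by (induction k) (simp_all add: mono_poly_zero Var_def mono_poly_add[symmetric] single_add[symmetric])

lemma prod_mono_poly: "(\<Prod>i\<in>A. mono_poly (f i)) = (mono_poly (\<Sum>i\<in>A. f i) :: 'k::comm_ring_1 mpoly)"
  by (induction A rule: infinite_finite_induct) (simp_all add: mono_poly_zero mono_poly_add)

definition tail_mono :: "nat \<Rightarrow> nat \<Rightarrow> (nat \<Rightarrow> nat ^ 'd) \<Rightarrow> nat ^ 'd \<Rightarrow> (nat \<Rightarrow> nat) \<Rightarrow> mono" where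
  "tail_mono n l m v s = Poly_Mapping.single 0 (l - delta n m v) + (\<Sum>i\<in>{1..n}. Poly_Mapping.single i (s i))"

lemma F_tail_eq: "F_tail n l m v s = (mono_poly (tail_mono n l m v s) :: 'k::comm_ring_1 mpoly)"
  unfolding F_tail_def tail_mono_def mono_poly_add Var_power prod_mono_poly ..

lemma F_poly_eq:
  "F_poly n l m v s = (mono_poly (Poly_Mapping.single (n + 1) l) - mono_poly (tail_mono n l m v s) :: 'k::comm_ring_1 mpoly)"
  unfolding F_poly_def F_tail_eq Var_power ..

lemma lookup_tail_mono:
  "Poly_Mapping.lookup (tail_mono n l m v s) i =
    (if i = 0 then l - delta n m v else if i \<le> n then s i else 0)"
  by (auto simp: tail_mono_def lookup_add lookup_sum lookup_single when_def intro!: sum.neutral)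

lemma tail_mono_in_monomials: "tail_mono n l m v s \<in> monomials {0..n}"
  by (auto simp: monomials_def in_keys_iff lookup_tail_mono split: if_splits)

lemma comb_cong: "(\<And>i. i \<in> {1..n} \<Longrightarrow> s i = s' i) \<Longrightarrow> comb n m s = comb n m s'"
  unfolding comb_def by (rule sum.cong) auto

lemma total_degree_split:
  assumes "t \<in> monomials {0..n}"
  shows "total_degree t = Poly_Mapping.lookup t 0 + (\<Sum>i\<in>{1..n}. Poly_Mapping.lookup t i)"
  using assms by (simp add: total_degree_eq_sum sum.atLeast_Suc_atMost)

text \<open>The power of \<open>x_0\<close> raises the total degree from \<open>delta n m v\<close>
  to \<open>l\<close>; the subtraction of natural numbers is exact because
  \<open>delta n m v \<le> l\<close>.\<close>

lemma hom_grading_tail_mono: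
  assumes "s \<in> minimal_reps n m v" "delta n m v \<le> l"
  shows "hom_grading n m (tail_mono n l m v s) = (l, v)"
proof -
  have "(\<Sum>i\<in>{1..n}. Poly_Mapping.lookup (tail_mono n l m v s) i) = (\<Sum>i\<in>{1..n}. s i)"
    by (rule sum.cong) (auto simp: lookup_tail_mono)
  then have "total_degree (tail_mono n l m v s) = l"
    using assms by (simp add: total_degree_split[OF tail_mono_in_monomials] lookup_tail_mono minimal_reps_def)
  moreover have "comb n m (Poly_Mapping.lookup (tail_mono n l m v s)) = comb n m s"
    by (rule comb_cong) (auto simp: lookup_tail_mono)
  ultimately show ?thesis using assms by (simp add: hom_grading_def minimal_reps_def)
qed

lemma delta_le: "v = comb n m s \<Longrightarrow> delta n m v \<le> (\<Sum>i\<in>{1..n}. s i)"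
  unfolding delta_def by (rule Least_le) auto

lemma ex_minimal_rep:
  assumes "v \<in> affine_semigroup n m"
  obtains s where "s \<in> minimal_reps n m v"
proof -
  obtain s0 where "v = comb n m s0" using assms by (auto simp: affine_semigroup_def)
  then have "\<exists>k s. v = comb n m s \<and> k = (\<Sum>i\<in>{1..n}. s i)" by blast
  from LeastI_ex[OF this] show ?thesis
    using that by (auto simp: minimal_reps_def delta_def)
qed

lemma comb_ext_gens:
  "comb (n + 1) (ext_gens n l m v) s $ j = l * comb n m s $ j + s (n + 1) * v $ j"
proof -
  have "comb (n + 1) (ext_gens n l m v) s $ j =
      (\<Sum>i\<in>{1..n}. s i * (ext_gens n l m v i $ j)) + s (n + 1) * (ext_gens n l m v (n + 1) $ j)"
    by (simp add: comb_def)
  also have "(\<Sum>i\<in>{1..n}. s i * (ext_gens n l m v i $ j)) = (\<Sum>i\<in>{1..n}. l * (s i * m i $ j))"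
    by (rule sum.cong) (auto simp: ext_gens_def)
  finally show ?thesis by (simp add: comb_def sum_distrib_left ext_gens_def)
qed

lemma hom_grading_ext_gens:
  assumes "t \<in> monomials {0..n}"
  shows "hom_grading (n + 1) (ext_gens n l m v) t = (total_degree t, l *s comb n m (Poly_Mapping.lookup t))"
proof -
  have "Poly_Mapping.lookup t (n + 1) = 0" using assms by (rule monomials_lookup_eq_0) simp
  then show ?thesis by (simp add: hom_grading_def vec_eq_iff comb_ext_gens del: One_nat_def add_Suc_right)
qed

lemma drop_last_var:
  assumes "t \<in> monomials {0..n + 1}"
  shows "drop_var (n + 1) t \<in> monomials {0..n}"
  using drop_var_monomials[OF assms, of "n + 1"] by (rule rev_subsetD) (intro monomials_mono, auto)

lemma monomials_Suc: "t \<in> monomials {0..n} \<Longrightarrow> t \<in> monomials {0..n + 1}"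
  using monomials_mono[of "{0..n}" "{0..n + 1}"] by auto

lemma polys_Suc: "f \<in> polys {0..n} \<Longrightarrow> f \<in> polys {0..n + 1}"
  using polys_mono[of "{0..n}" "{0..n + 1}"] by auto

text \<open>Modulo \<open>l\<close> only the new variable contributes to the semigroup degree,
  namely its exponent times \<open>v\<close>. Cancelling a component of \<open>v\<close> coprime to
  \<open>l\<close> leaves congruent exponents, which are equal since both are below
  \<open>l\<close>. What remains is \<open>l\<close> times the old degree.\<close>

lemma hom_grading_drop_last_var:
  assumes cop: "\<exists>j. coprime l (v $ j)"
    and t: "t \<in> monomials {0..n + 1}" "Poly_Mapping.lookup t (n + 1) < l"
    and u: "u \<in> monomials {0..n + 1}" "Poly_Mapping.lookup u (n + 1) < l"
    and eq: "hom_grading (n + 1) (ext_gens n l m v) t = hom_grading (n + 1) (ext_gens n l m v) u"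
  shows "Poly_Mapping.lookup t (n + 1) = Poly_Mapping.lookup u (n + 1) \<and>
    hom_grading n m (drop_var (n + 1) t) = hom_grading n m (drop_var (n + 1) u)"
proof -
  let ?a = "Poly_Mapping.lookup t (n + 1)" and ?b = "Poly_Mapping.lookup u (n + 1)"
  let ?A = "comb n m (Poly_Mapping.lookup t)" and ?B = "comb n m (Poly_Mapping.lookup u)"
  have comb: "l * ?A $ j + ?a * v $ j = l * ?B $ j + ?b * v $ j" for j
    using eq comb_ext_gens[of n l m v "Poly_Mapping.lookup t" j]
      comb_ext_gens[of n l m v "Poly_Mapping.lookup u" j] unfolding hom_grading_def by simp
  obtain j where j: "coprime l (v $ j)" using cop by blast
  have "(l * ?A $ j + ?a * v $ j) mod l = (l * ?B $ j + ?b * v $ j) mod l"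
    using comb[of j] by simp
  then have "[?a * v $ j = ?b * v $ j] (mod l)" by (simp add: cong_def)
  then have "[?a = ?b] (mod l)"
    using j by (subst (asm) cong_mult_rcancel_nat) (auto simp: coprime_commute)
  then have ab: "?a = ?b" using t u by (simp add: cong_def)
  \<comment> \<open>Cancelling \<open>l\<close> requires it to be positive, which follows from the
    bound on the exponent in \<open>t\<close>.\<close>
  have "?A = ?B" unfolding vec_eq_iff using comb t ab by auto
  moreover have drop: "comb n m (Poly_Mapping.lookup (drop_var (n + 1) w)) = comb n m (Poly_Mapping.lookup w)" for w
    by (rule comb_cong) (auto simp: lookup_drop_var)
  moreover have deg: "total_degree w = total_degree (drop_var (n + 1) w) + Poly_Mapping.lookup w (n + 1)" for w
    by (metis drop_var_add_single total_degree_add total_degree_single)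
  have "total_degree (drop_var (n + 1) t) = total_degree (drop_var (n + 1) u)"
    using eq deg[of t] deg[of u] ab by (simp add: hom_grading_def)
  ultimately show ?thesis using ab by (simp only: hom_grading_def)
qed

text \<open>The relation \<open>R\<close> stands for congruence modulo the ideal of \<open>F\<close> and for the term order.\<close>

lemma reduce_last_var:
  assumes "l > 0" and t: "t \<in> monomials {0..n + 1}" and b: "b \<in> monomials {0..n}"
    and refl: "\<And>t. t \<in> monomials {0..n + 1} \<Longrightarrow> R t t"
    and trans: "\<And>t u w. R t u \<Longrightarrow> R u w \<Longrightarrow> R t w"
    and step: "\<And>w. w \<in> monomials {0..n + 1} \<Longrightarrow> R (w + b) (w + Poly_Mapping.single (n + 1) l)"
  shows "\<exists>t'. t' \<in> monomials {0..n + 1} \<and> Poly_Mapping.lookup t' (n + 1) < l \<and> R t' t"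
  using t
proof (induction "Poly_Mapping.lookup t (n + 1)" arbitrary: t rule: less_induct)
  case less
  show ?case
  proof (cases "Poly_Mapping.lookup t (n + 1) < l")
    case True
    then show ?thesis using refl less.prems by blast
  next
    case False
    define w where "w = t - Poly_Mapping.single (n + 1) l"
    have t: "t = w + Poly_Mapping.single (n + 1) l"
      unfolding w_def using False
      by (intro poly_mapping_eqI) (auto simp: lookup_add lookup_minus lookup_single when_def)
    have w: "w \<in> monomials {0..n + 1}" using less.prems t by simp
    have "Poly_Mapping.lookup b (n + 1) = 0" using b by (rule monomials_lookup_eq_0) simp
    then have "Poly_Mapping.lookup (w + b) (n + 1) < Poly_Mapping.lookup t (n + 1)"
      using \<open>l > 0\<close> by (simp add: t lookup_add)
    moreover have "w + b \<in> monomials {0..n + 1}" using w monomials_Suc[OF b] by simp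
    ultimately obtain t' where "t' \<in> monomials {0..n + 1}" "Poly_Mapping.lookup t' (n + 1) < l" "R t' (w + b)"
      using less.hyps by blast
    then show ?thesis using trans step[OF w] t by blast
  qed
qed

section \<open>The extended ideal as the sum of the old ideal and the ideal of
  \<open>F\<close>\<close>

locale adjoined_generator =
  fixes n l :: nat and m :: "nat \<Rightarrow> nat ^ 'd" and v :: "nat ^ 'd" and s :: "nat \<Rightarrow> nat"
  assumes l_pos: "l > 0"
    and coprime: "\<exists>j. coprime l (v $ j)"
    and delta_le_l: "delta n m v \<le> l"
    and minimal_rep: "s \<in> minimal_reps n m v"
begin

abbreviation "\<phi> \<equiv> hom_grading n m"
abbreviation "\<psi> \<equiv> hom_grading (n + 1) (ext_gens n l m v)"
abbreviation "lead_F \<equiv> Poly_Mapping.single (n + 1) l"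
abbreviation "tail_F \<equiv> tail_mono n l m v s"
abbreviation "F \<equiv> F_poly n l m v s"

lemma grading_tail_F: "\<phi> tail_F = (l, v)"
  using minimal_rep delta_le_l by (rule hom_grading_tail_mono)

lemma lead_F_in_monomials: "lead_F \<in> monomials {0..n + 1}"
  by (rule monomials_single) simp

text \<open>Both degrees are \<open>(l, l *s v)\<close>: the tail has old degree \<open>v\<close>,
  which the new generators scale by \<open>l\<close>, and the lead is the \<open>l\<close>-th power
  of a variable of degree \<open>v\<close>.\<close>

lemma grading_lead_F: "\<psi> lead_F = \<psi> tail_F"
proof -
  have "total_degree tail_F = l" "comb n m (Poly_Mapping.lookup tail_F) = v"
    using grading_tail_F by (simp_all add: hom_grading_def)
  then have "\<psi> tail_F = (l, l *s v)" by (simp only: hom_grading_ext_gens[OF tail_mono_in_monomials])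
  moreover have "comb n m (Poly_Mapping.lookup lead_F) = comb n m (\<lambda>i. 0)"
    by (rule comb_cong) (auto simp: lookup_single)
  then have "comb n m (Poly_Mapping.lookup lead_F) = 0" by (simp add: comb_def vec_eq_iff)
  then have "\<psi> lead_F = (l, l *s v)"
    unfolding hom_grading_def prod.inject
    by (simp add: vec_eq_iff comb_ext_gens del: One_nat_def add_Suc_right)
  ultimately show ?thesis by simp
qed

lemma lead_F_neq_tail_F: "lead_F \<noteq> tail_F"
proof
  assume "lead_F = tail_F"
  then have "Poly_Mapping.lookup lead_F (n + 1) = Poly_Mapping.lookup tail_F (n + 1)" by simp
  then show False using l_pos by (simp add: lookup_tail_mono)
qed

lemma F_in_fiber_ideal: "F \<in> (fiber_ideal {0..n + 1} \<psi> :: 'k::comm_ring_1 mpoly set)"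
  unfolding F_poly_eq
  by (intro binomial_in_fiber_ideal lead_F_in_monomials grading_lead_F monomials_Suc tail_mono_in_monomials)

text \<open>On monomials in the old variables \<open>\<psi>\<close> is \<open>\<phi>\<close>
  followed by scaling the semigroup component by \<open>l\<close>, so a test function of
  \<open>\<psi>\<close> is also one of \<open>\<phi>\<close>.\<close>

lemma fiber_ideal_subset_ext: "(fiber_ideal {0..n} \<phi> :: 'k::comm_ring_1 mpoly set) \<subseteq> fiber_ideal {0..n + 1} \<psi>"
proof
  fix f :: "'k mpoly" assume f: "f \<in> fiber_ideal {0..n} \<phi>"
  then have fX: "f \<in> polys {0..n}" by (simp add: fiber_ideal_def)
  have "weighted_sum f (\<lambda>t. h (\<psi> t)) = 0" for h
  proof -
    have "weighted_sum f (\<lambda>t. h (\<psi> t)) = weighted_sum f (\<lambda>t. (\<lambda>(e, w). h (e, l *s w)) (\<phi> t))"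
      by (rule weighted_sum_cong, subst hom_grading_ext_gens[OF polysD[OF fX]]) (simp_all add: hom_grading_def)
    then show ?thesis using fiber_idealD[OF f] by simp
  qed
  then show "f \<in> fiber_ideal {0..n + 1} \<psi>" using polys_Suc[OF fX] by (simp add: fiber_ideal_def)
qed

text \<open>It suffices to treat binomials. If \<open>t'\<close> and \<open>u'\<close> are the
  reductions of \<open>t\<close> and \<open>u\<close> by \<open>F\<close>, the binomial of
  \<open>t\<close> and \<open>u\<close> is that of \<open>t'\<close> and \<open>u'\<close> plus a
  multiple of \<open>F\<close>, and the binomial of \<open>t'\<close> and \<open>u'\<close> is a
  power of \<open>x_{n+1}\<close> times a binomial of the old ideal.\<close>

theorem fiber_ideal_eq_sum:
  "(fiber_ideal {0..n + 1} \<psi> :: 'k::comm_ring_1 mpoly set) =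
    genideal (poly_ring {0..n + 1}) (fiber_ideal {0..n} \<phi>)
    <+>\<^bsub>poly_ring {0..n + 1}\<^esub> genideal (poly_ring {0..n + 1}) {F}"
    (is "?J' = ?I <+>\<^bsub>?P\<^esub> ?I'")
proof
  have J': "ideal ?J' ?P" by (intro ideal_fiber_ideal hom_grading_add)
  have I: "ideal ?I ?P" and J_sub: "fiber_ideal {0..n} \<phi> \<subseteq> ?I"
    using fiber_ideal_subset_ext poly_ideal_subset[OF J']
    by (intro poly_genideal poly_genideal_self, blast)+
  have I': "ideal ?I' ?P" and F: "F \<in> ?I'"
    using F_in_fiber_ideal poly_ideal_subset[OF J']
      poly_genideal_self[of "{F :: 'k mpoly}" "{0..n + 1}"]
    by (auto intro!: poly_genideal)
  have sum: "(f \<in> ?I <+>\<^bsub>?P\<^esub> ?I') \<longleftrightarrow> (\<exists>a\<in>?I. \<exists>b\<in>?I'. f = a + b)" for f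
    by (simp add: set_add_def')
  have "?I \<subseteq> ?J'" "?I' \<subseteq> ?J'"
    using fiber_ideal_subset_ext F_in_fiber_ideal by (intro poly_genideal_minimal[OF J']; blast)+
  then show "?I <+>\<^bsub>?P\<^esub> ?I' \<subseteq> ?J'"
    using poly_ideal_add[OF J'] unfolding sum subset_iff by blast
  show "?J' \<subseteq> ?I <+>\<^bsub>?P\<^esub> ?I'"
  proof (rule fiber_ideal_subset)
    show "ideal (?I <+>\<^bsub>?P\<^esub> ?I') ?P" using ring.add_ideals[OF ring_poly_ring I I'] .
    fix t u assume t: "t \<in> monomials {0..n + 1}" and u: "u \<in> monomials {0..n + 1}" and eq: "\<psi> t = \<psi> u"
    \<comment> \<open>Equality of degrees is carried along with congruence modulo \<open>F\<close>,
      so that \<open>hom_grading_drop_last_var\<close> applies to the reduced monomials.\<close>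
    define R where "R t' t \<longleftrightarrow> \<psi> t' = \<psi> t \<and> (mono_poly t - mono_poly t' :: 'k mpoly) \<in> ?I'" for t' t
    have refl: "R t t" for t using poly_ideal_zero[OF I'] by (simp add: R_def)
    have trans: "R t u \<Longrightarrow> R u w \<Longrightarrow> R t w" for t u w
      using poly_ideal_add[OF I', of "mono_poly u - mono_poly t" "mono_poly w - mono_poly u"]
      by (simp add: R_def)
    have step: "R (w + tail_F) (w + lead_F)" if "w \<in> monomials {0..n + 1}" for w
      using poly_ideal_mult[OF I' F, of "mono_poly w"] that grading_lead_F
      by (simp add: R_def F_poly_eq mono_poly_add right_diff_distrib hom_grading_add)
    have reduce: "\<exists>t'. t' \<in> monomials {0..n + 1} \<and> Poly_Mapping.lookup t' (n + 1) < l \<and> R t' t"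
      if "t \<in> monomials {0..n + 1}" for t
      by (rule reduce_last_var[where R = R and b = tail_F])
        (use l_pos that tail_mono_in_monomials refl trans step in blast)+
    obtain t' where t': "t' \<in> monomials {0..n + 1}" "Poly_Mapping.lookup t' (n + 1) < l" "R t' t"
      using reduce[OF t] by blast
    obtain u' where u': "u' \<in> monomials {0..n + 1}" "Poly_Mapping.lookup u' (n + 1) < l" "R u' u"
      using reduce[OF u] by blast
    have "\<psi> t' = \<psi> u'" using t' u' eq by (simp add: R_def)
    from hom_grading_drop_last_var[OF coprime t'(1,2) u'(1,2) this]
    have last: "Poly_Mapping.lookup t' (n + 1) = Poly_Mapping.lookup u' (n + 1)"
      and drop: "\<phi> (drop_var (n + 1) t') = \<phi> (drop_var (n + 1) u')" by auto
    let ?w = "Poly_Mapping.single (n + 1) (Poly_Mapping.lookup u' (n + 1))"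
    have "mono_poly (drop_var (n + 1) t') - mono_poly (drop_var (n + 1) u') \<in> (fiber_ideal {0..n} \<phi> :: 'k mpoly set)"
      using t' u' drop by (intro binomial_in_fiber_ideal drop_last_var)
    then have "mono_poly ?w * (mono_poly (drop_var (n + 1) t') - mono_poly (drop_var (n + 1) u')) \<in> ?I"
      using J_sub by (intro poly_ideal_mult[OF I]) (auto intro: monomials_single)
    moreover have "?w + drop_var (n + 1) t' = t'" "?w + drop_var (n + 1) u' = u'"
      using drop_var_add_single[of "n + 1" t'] drop_var_add_single[of "n + 1" u'] last
      by (simp_all add: add.commute)
    ultimately have 1: "(mono_poly t' - mono_poly u' :: 'k mpoly) \<in> ?I"
      by (simp only: right_diff_distrib mono_poly_add[symmetric])
    have 2: "(mono_poly t - mono_poly t') - (mono_poly u - mono_poly u') \<in> ?I'"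
      by (rule poly_ideal_diff[OF I']) (use t' u' in \<open>auto simp: R_def\<close>)
    show "mono_poly t - mono_poly u \<in> ?I <+>\<^bsub>?P\<^esub> ?I'"
      unfolding sum by (rule bexI[OF _ 1], rule bexI[OF _ 2]) simp
  qed
qed

end

section \<open>Leading monomials and Groebner bases in the extended ring\<close>

context adjoined_generator
begin

lemma F_in_polys: "F \<in> (polys {0..n + 1} :: 'k::comm_ring_1 mpoly set)"
  using F_in_fiber_ideal[where 'k = 'k] by (simp add: fiber_ideal_def)

lemma keys_F: "Poly_Mapping.keys (F :: 'k::comm_ring_1 mpoly) = {lead_F, tail_F}"
  unfolding F_poly_eq using lead_F_neq_tail_F by (rule keys_binomial)

lemma F_nonzero: "(F :: 'k::comm_ring_1 mpoly) \<noteq> 0"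
  using keys_F[where 'k = 'k] by (metis keys_zero insert_not_empty)

lemma lead_F_notin_monomials: "lead_F \<notin> monomials {0..n}"
  using l_pos monomials_lookup_eq_0[of lead_F "{0..n}" "n + 1"] by auto

lemma F_notin_polys: "(F :: 'k::comm_ring_1 mpoly) \<notin> polys {0..n}"
  using lead_F_notin_monomials keys_F[where 'k = 'k] polysD[of "F :: 'k mpoly" "{0..n}" lead_F] by auto

context
  fixes r r' :: "mono rel"
  assumes order: "term_order {0..n} r" and refining: "refining_order n r r'"
begin

lemma order': "term_order {0..n + 1} r'"
  and big: "biggest_var {0..n + 1} r' (n + 1)"
  using refining by (simp_all add: refining_order_def)

lemma restr_iff: "t \<in> monomials {0..n} \<Longrightarrow> u \<in> monomials {0..n} \<Longrightarrow> (t, u) \<in> r' \<longleftrightarrow> (t, u) \<in> r"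
  using refining by (auto simp: refining_order_def)

lemma tail_F_le_lead_F: "(tail_F, lead_F) \<in> r'"
  using le_biggest_var_power[OF order' big monomials_Suc[OF tail_mono_in_monomials], of l m v s] grading_tail_F
  by (simp add: hom_grading_def)

lemma lead_mono_F: "lead_mono r' (F :: 'k::comm_ring_1 mpoly) = lead_F"
  unfolding F_poly_eq using lead_F_neq_tail_F
  by (intro lead_mono_binomial[OF order' tail_F_le_lead_F]) simp

lemma lead_mono_restrict:
  assumes f: "f \<in> polys {0..n}" "f \<noteq> 0"
  shows "lead_mono r' f = lead_mono r f"
proof (rule lead_mono_eqI[OF order'])
  show "lead_mono r f \<in> Poly_Mapping.keys f" by (rule lead_mono_in_keys[OF order f])
  fix u assume u: "u \<in> Poly_Mapping.keys f"
  then show "(u, lead_mono r f) \<in> r'"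
    using restr_iff[of u "lead_mono r f"] lead_mono_ge[OF order f u] lead_mono_in_monomials[OF order f]
      polysD[OF f(1) u] by simp
qed

text \<open>The lead of \<open>F\<close> contains \<open>x_{n+1}\<close> and cannot divide
  \<open>t\<close>, and both orders give old polynomials the same leading monomial. The form
  \<open>A = B\<close> serves to test the tail of \<open>F\<close> against \<open>G\<close>; the
  other one tests an element of \<open>G\<close> against the remaining basis with
  \<open>F\<close>.\<close>

lemma initial_ideal_restrict:
  fixes B :: "'k::comm_ring_1 mpoly set"
  assumes B: "B \<subseteq> polys {0..n}" and t: "t \<in> monomials {0..n}"
    and A: "A = B \<or> A = insert F B"
  shows "mono_poly t \<in> initial_ideal {0..n + 1} r' A \<longleftrightarrow> mono_poly t \<in> initial_ideal {0..n} r B"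
proof -
  have A_sub: "A \<subseteq> polys {0..n + 1}" using A B polys_Suc F_in_polys by auto
  have notF: "t \<noteq> lead_mono r' (F :: 'k mpoly) + w" for w
    using t lead_F_notin_monomials by (auto simp: lead_mono_F)
  have "(\<exists>f\<in>A. f \<noteq> 0 \<and> (\<exists>w. t = lead_mono r' f + w)) \<longleftrightarrow>
      (\<exists>f\<in>B. f \<noteq> 0 \<and> (\<exists>w. t = lead_mono r' f + w))"
    using A notF by blast
  also have "\<dots> \<longleftrightarrow> (\<exists>f\<in>B. f \<noteq> 0 \<and> (\<exists>w. t = lead_mono r f + w))"
    using B by (intro bex_cong conj_cong refl) (auto simp: lead_mono_restrict)
  finally have iff: "(\<exists>f\<in>A. f \<noteq> 0 \<and> (\<exists>w. t = lead_mono r' f + w)) \<longleftrightarrow>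
      (\<exists>f\<in>B. f \<noteq> 0 \<and> (\<exists>w. t = lead_mono r f + w))" .
  show ?thesis
    unfolding mono_poly_in_initial_ideal_iff[OF order B]
    using t monomials_Suc[OF t] iff by (simp only: mono_poly_in_initial_ideal_iff[OF order' A_sub])
qed

text \<open>Replacing \<open>u\<close> by its normal form modulo \<open>F\<close> only makes it smaller, so a reduction of \<open>t\<close>
  may be assumed not to involve the new variable.\<close>

lemma reducible_descend:
  assumes ut: "u \<noteq> t" "(u, t) \<in> r'" "\<psi> u = \<psi> t" and tl: "Poly_Mapping.lookup t (n + 1) < l"
  shows "\<exists>w. w \<noteq> drop_var (n + 1) t \<and> (w, drop_var (n + 1) t) \<in> r \<and> \<phi> w = \<phi> (drop_var (n + 1) t)"
proof -
  have u: "u \<in> monomials {0..n + 1}" and t: "t \<in> monomials {0..n + 1}"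
    using term_order_subset[OF order' ut(2)] by auto
  define R where "R t' t \<longleftrightarrow> \<psi> t' = \<psi> t \<and> (t', t) \<in> r'" for t' t
  have refl: "R t t" if "t \<in> monomials {0..n + 1}" for t
    using term_order_refl[OF order' that] by (simp add: R_def)
  have trans: "R t u \<Longrightarrow> R u w \<Longrightarrow> R t w" for t u w
    using term_order_trans[OF order'] by (auto simp: R_def)
  have step: "R (w + tail_F) (w + lead_F)" if "w \<in> monomials {0..n + 1}" for w
    using term_order_add[OF order' tail_F_le_lead_F that] grading_lead_F
    by (simp add: R_def hom_grading_add add.commute)
  have "\<exists>u'. u' \<in> monomials {0..n + 1} \<and> Poly_Mapping.lookup u' (n + 1) < l \<and> R u' u"
    by (rule reduce_last_var[where R = R and b = tail_F])
      (use l_pos u tail_mono_in_monomials refl trans step in blast)+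
  then obtain u' where u': "u' \<in> monomials {0..n + 1}" "Poly_Mapping.lookup u' (n + 1) < l"
      "\<psi> u' = \<psi> t" "(u', u) \<in> r'" using ut(3) by (auto simp: R_def)
  \<comment> \<open>If \<open>u'\<close> were \<open>t\<close>, then \<open>t\<close> would lie
    below \<open>u\<close>, and antisymmetry would give \<open>u = t\<close>.\<close>
  have less: "(u', t) \<in> r'" "u' \<noteq> t"
    using term_order_trans[OF order' u'(4) ut(2)] term_order_antisym[OF order' ut(2)] u'(4) ut(1) by auto
  let ?w = "Poly_Mapping.single (n + 1) (Poly_Mapping.lookup t (n + 1))"
  have last: "Poly_Mapping.lookup u' (n + 1) = Poly_Mapping.lookup t (n + 1)"
    and drop: "\<phi> (drop_var (n + 1) u') = \<phi> (drop_var (n + 1) t)"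
    using hom_grading_drop_last_var[OF coprime u'(1,2) t tl u'(3)] by auto
  have split: "drop_var (n + 1) u' + ?w = u'" "drop_var (n + 1) t + ?w = t"
    using drop_var_add_single[of "n + 1" u'] drop_var_add_single[of "n + 1" t] last by simp_all
  have "(drop_var (n + 1) u' + ?w, drop_var (n + 1) t + ?w) \<in> r'"
    unfolding split by (rule less)
  then have "(drop_var (n + 1) u', drop_var (n + 1) t) \<in> r'"
    by (rule term_order_add_cancel[OF order' monomials_Suc[OF drop_last_var[OF u'(1)]]
      monomials_Suc[OF drop_last_var[OF t]]])
  then have "(drop_var (n + 1) u', drop_var (n + 1) t) \<in> r"
    using restr_iff[OF drop_last_var[OF u'(1)] drop_last_var[OF t]] by simp
  moreover have "drop_var (n + 1) u' \<noteq> drop_var (n + 1) t"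
    using less(2) split by metis
  ultimately show ?thesis using drop by blast
qed

context
  fixes G :: "'k::comm_ring_1 mpoly set"
  assumes reduced: "reduced_groebner_basis {0..n} r (fiber_ideal {0..n} \<phi>) G"
begin

lemma G_subset: "G \<subseteq> fiber_ideal {0..n} \<phi>" "G \<subseteq> polys {0..n}"
  and G_initial: "initial_ideal {0..n} r G = initial_ideal {0..n} r (fiber_ideal {0..n} \<phi>)"
  and G_finite: "finite G" and G_nonzero: "0 \<notin> G"
  using reduced by (auto simp: reduced_groebner_basis_def groebner_basis_def fiber_ideal_def)

lemma F_notin_G: "F \<notin> G"
  using G_subset F_notin_polys by blast

lemma G_lead:
  assumes "g \<in> G"
  shows "lead_mono r' g = lead_mono r g" "lead_mono r g \<in> Poly_Mapping.keys g" "lead_coef r' g = 1"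
    "t \<in> Poly_Mapping.keys g \<Longrightarrow> t \<in> monomials {0..n}"
    "t \<in> Poly_Mapping.keys g \<Longrightarrow> mono_poly t \<notin> initial_ideal {0..n} r (G - {g})"
proof -
  have g: "g \<in> polys {0..n}" "g \<noteq> 0" using assms G_subset G_nonzero by auto
  show eq: "lead_mono r' g = lead_mono r g" by (rule lead_mono_restrict[OF g])
  show "lead_mono r g \<in> Poly_Mapping.keys g" by (rule lead_mono_in_keys[OF order g])
  show "lead_coef r' g = 1"
    using reduced assms by (simp add: reduced_groebner_basis_def lead_coef_def eq)
  show "t \<in> Poly_Mapping.keys g \<Longrightarrow> t \<in> monomials {0..n}" using g(1) by (rule polysD)
  show "t \<in> Poly_Mapping.keys g \<Longrightarrow> mono_poly t \<notin> initial_ideal {0..n} r (G - {g})"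
    using reduced assms by (simp add: reduced_groebner_basis_def)
qed

text \<open>A leading monomial whose exponent of \<open>x_{n+1}\<close> is at least \<open>l\<close>
  is divisible by that of \<open>F\<close>. Otherwise a smaller monomial of the same degree descends
  to the old variables, and a leading monomial from \<open>G\<close> divides what remains after
  dropping \<open>x_{n+1}\<close>.\<close>

lemma groebner_basis_adjoin:
  "groebner_basis {0..n + 1} r' (fiber_ideal {0..n + 1} \<psi>) (G \<union> {F})"
proof (rule groebner_basisI[OF order'])
  show "finite (G \<union> {F})" using G_finite by simp
  show "G \<union> {F} \<subseteq> fiber_ideal {0..n + 1} \<psi>"
    using G_subset fiber_ideal_subset_ext F_in_fiber_ideal by blast
  show sub: "(fiber_ideal {0..n + 1} \<psi> :: 'k mpoly set) \<subseteq> polys {0..n + 1}" by (auto simp: fiber_ideal_def)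
  have GF: "G \<union> {F} \<subseteq> polys {0..n + 1}" using G_subset polys_Suc F_in_polys by auto
  fix f :: "'k mpoly" assume f: "f \<in> fiber_ideal {0..n + 1} \<psi>" "f \<noteq> 0"
  have fX: "f \<in> polys {0..n + 1}" using f sub by blast
  let ?t = "lead_mono r' f"
  have t: "?t \<in> monomials {0..n + 1}" by (rule lead_mono_in_monomials[OF order' fX f(2)])
  obtain u where u: "u \<in> Poly_Mapping.keys f" "u \<noteq> ?t" "\<psi> u = \<psi> ?t"
    using fiber_ideal_other_key[OF f(1) lead_mono_in_keys[OF order' fX f(2)]] by blast
  have "\<exists>g\<in>G \<union> {F}. g \<noteq> 0 \<and> (\<exists>w. ?t = lead_mono r' g + w)"
  proof (cases "Poly_Mapping.lookup ?t (n + 1) < l")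
    case True
    let ?d = "drop_var (n + 1) ?t"
    have "mono_poly ?d \<in> initial_ideal {0..n} r G"
      unfolding G_initial mono_poly_in_initial_fiber_ideal_iff[OF order hom_grading_add]
      using reducible_descend[OF u(2) lead_mono_ge[OF order' fX f(2) u(1)] u(3) True] .
    then obtain g w where g: "g \<in> G" "g \<noteq> 0" "?d = lead_mono r g + w"
      unfolding mono_poly_in_initial_ideal_iff[OF order G_subset(2)] by blast
    then have "?t = lead_mono r' g + (w + Poly_Mapping.single (n + 1) (Poly_Mapping.lookup ?t (n + 1)))"
      using drop_var_add_single[of "n + 1" ?t] by (simp add: G_lead add.assoc)
    then show ?thesis using g by blast
  next
    case False
    then have "?t = lead_F + (?t - lead_F)"
      by (intro poly_mapping_eqI) (auto simp: lookup_add lookup_minus lookup_single when_def)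
    then show ?thesis unfolding lead_mono_F[symmetric, where 'k = 'k] using F_nonzero by blast
  qed
  then show "mono_poly ?t \<in> initial_ideal {0..n + 1} r' (G \<union> {F})"
    unfolding mono_poly_in_initial_ideal_iff[OF order' GF] using t by blast
qed

text \<open>The leading monomial of an element \<open>g\<close> of \<open>G\<close> is free of
  \<open>x_{n+1}\<close>, so it divides a power of \<open>x_{n+1}\<close> only if it is 1. But
  \<open>g\<close> has a second monomial, below its leading one, and nothing lies below 1.\<close>

lemma F_lead_irreducible: "mono_poly lead_F \<notin> initial_ideal {0..n + 1} r' G"
proof
  have G: "G \<subseteq> polys {0..n + 1}" using G_subset polys_Suc by auto
  assume "mono_poly lead_F \<in> initial_ideal {0..n + 1} r' G"
  then obtain g w where g: "g \<in> G" "g \<noteq> 0" "lead_F = lead_mono r' g + w"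
    unfolding mono_poly_in_initial_ideal_iff[OF order' G] by blast
  have mon: "lead_mono r g \<in> monomials {0..n}" using G_lead[OF g(1)] by blast
  have "lead_mono r g = 0"
  proof (rule poly_mapping_eqI)
    fix i
    have "Poly_Mapping.lookup lead_F i = Poly_Mapping.lookup (lead_mono r g) i + Poly_Mapping.lookup w i"
      using g G_lead[OF g(1)] by (simp add: lookup_add)
    then show "Poly_Mapping.lookup (lead_mono r g) i = Poly_Mapping.lookup 0 i"
      using monomials_lookup_eq_0[OF mon, of "n + 1"] by (cases "i = n + 1") (auto simp: lookup_single)
  qed
  moreover obtain u where u: "u \<in> Poly_Mapping.keys g" "u \<noteq> lead_mono r g"
    using fiber_ideal_other_key[of g "{0..n}" \<phi>] G_subset(1) g(1) G_lead(2)[OF g(1)] by blast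
  moreover have "(u, lead_mono r g) \<in> r"
    using lead_mono_ge[OF order _ g(2) u(1)] G_subset(2) g(1) by blast
  moreover have "(0, u) \<in> r" using term_order_zero[OF order] G_lead(4)[OF g(1) u(1)] by blast
  ultimately show False using term_order_antisym[OF order] by metis
qed

lemma initial_ideal_without:
  assumes g: "g \<in> G" and t: "t \<in> Poly_Mapping.keys g"
  shows "mono_poly t \<notin> initial_ideal {0..n + 1} r' ((G \<union> {F}) - {g})"
proof -
  have "(G \<union> {F}) - {g} = insert F (G - {g})" using g F_notin_G by auto
  then show ?thesis
    using initial_ideal_restrict[of "G - {g}" t "insert F (G - {g})"] G_subset(2) G_lead(4,5)[OF g t]
    by auto
qed

lemma without_F: "(G \<union> {F}) - {F} = G"
  using F_notin_G by auto

lemma lead_coef_F: "lead_coef r' (F :: 'k mpoly) = 1"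
proof -
  have "Poly_Mapping.lookup (F :: 'k mpoly) lead_F = 1"
    unfolding F_poly_eq using lead_F_neq_tail_F
    by (simp add: mono_poly_def lookup_minus lookup_single when_def)
  then show ?thesis by (simp only: lead_coef_def lead_mono_F)
qed

theorem minimal_groebner_basis_adjoin:
  "minimal_groebner_basis {0..n + 1} r' (fiber_ideal {0..n + 1} \<psi>) (G \<union> {F})"
  unfolding minimal_groebner_basis_def
proof (intro conjI ballI)
  show "0 \<notin> G \<union> {F}" using G_nonzero F_nonzero by auto
next
  fix g assume "g \<in> G \<union> {F}"
  then consider "g \<in> G" | "g = F" by blast
  then show "lead_coef r' g = 1"
    by cases (simp_all only: G_lead(3) lead_coef_F)
next
  fix g assume "g \<in> G \<union> {F}"
  then consider "g \<in> G" | "g = F" by blast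
  then show "mono_poly (lead_mono r' g) \<notin> initial_ideal {0..n + 1} r' (G \<union> {F} - {g})"
  proof cases
    case 1
    then show ?thesis using initial_ideal_without G_lead(1,2) by simp
  next
    case 2
    show ?thesis unfolding 2 without_F lead_mono_F by (rule F_lead_irreducible)
  qed
qed (rule groebner_basis_adjoin)

text \<open>Adding \<open>F\<close> cannot make a monomial of an element of \<open>G\<close>
  reducible, and the lead of \<open>F\<close> is irreducible. Only the tail is left to test; being
  free of \<open>x_{n+1}\<close>, it can be tested in the old ring.\<close>

theorem reduced_groebner_basis_adjoin_iff:
  "reduced_groebner_basis {0..n + 1} r' (fiber_ideal {0..n + 1} \<psi>) (G \<union> {F}) \<longleftrightarrow>
    F_tail n l m v s \<notin> initial_ideal {0..n} r (fiber_ideal {0..n} \<phi> :: 'k mpoly set)"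
proof -
  have tail: "mono_poly tail_F \<in> initial_ideal {0..n + 1} r' G \<longleftrightarrow>
      F_tail n l m v s \<in> initial_ideal {0..n} r (fiber_ideal {0..n} \<phi> :: 'k mpoly set)"
    unfolding F_tail_eq G_initial[symmetric]
    by (rule initial_ideal_restrict[OF G_subset(2) tail_mono_in_monomials]) simp
  have "reduced_groebner_basis {0..n + 1} r' (fiber_ideal {0..n + 1} \<psi>) (G \<union> {F}) \<longleftrightarrow>
    (\<forall>g\<in>G \<union> {F}. \<forall>t\<in>Poly_Mapping.keys g. mono_poly t \<notin> initial_ideal {0..n + 1} r' (G \<union> {F} - {g}))"
    using minimal_groebner_basis_adjoin
    unfolding minimal_groebner_basis_def reduced_groebner_basis_def by blast
  also have "\<dots> \<longleftrightarrow> (\<forall>t\<in>Poly_Mapping.keys (F :: 'k mpoly). mono_poly t \<notin> initial_ideal {0..n + 1} r' (G \<union> {F} - {F}))"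
    (is "(\<forall>g\<in>_. ?P g) \<longleftrightarrow> _")
  proof -
    have "\<forall>g\<in>G. ?P g" using initial_ideal_without by blast
    then show ?thesis by blast
  qed
  also have "\<dots> \<longleftrightarrow> mono_poly tail_F \<notin> initial_ideal {0..n + 1} r' G"
    unfolding without_F keys_F using F_lead_irreducible by blast
  finally show ?thesis by (simp only: tail)
qed

end

end

end

text \<open>The tail has the largest power of \<open>x\<^sub>0\<close> in its fibre, so for a reverse lexicographic
  order only the tails of the other minimal representations can be smaller.\<close>

lemma ex_irreducible_tail:
  assumes v: "v \<in> affine_semigroup n m" and l: "delta n m v \<le> l"
    and order: "term_order {0..n} r" and revlex: "revlex_smallest_var {0..n} r 0"
  shows "\<exists>s\<in>minimal_reps n m v. F_tail n l m v s \<notin>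
    initial_ideal {0..n} r (fiber_ideal {0..n} (hom_grading n m) :: 'k::comm_ring_1 mpoly set)"
proof -
  \<comment> \<open>These are the tails of all minimal representations; the least of them provides
    \<open>s\<close>.\<close>
  let ?T = "{t \<in> monomials {0..n}. hom_grading n m t = (l, v) \<and> Poly_Mapping.lookup t 0 = l - delta n m v}"
  have "finite ?T"
    by (rule finite_subset[OF _ finite_monomials_total_degree[of "{0..n}" l]]) (auto simp: hom_grading_def)
  moreover obtain s0 where "s0 \<in> minimal_reps n m v" using ex_minimal_rep[OF v] .
  then have "tail_mono n l m v s0 \<in> ?T"
    using hom_grading_tail_mono[OF _ l] by (simp add: tail_mono_in_monomials lookup_tail_mono)
  then have "?T \<noteq> {}" by blast
  moreover have "linear_order_on (monomials {0..n}) (r\<inverse>)"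
    using order by (simp add: term_order_def)
  ultimately obtain t where t: "t \<in> ?T" and min: "\<And>u. u \<in> ?T \<Longrightarrow> (t, u) \<in> r"
    using linear_order_on_ex_max[of "monomials {0..n}" "r\<inverse>" ?T] by auto
  let ?s = "Poly_Mapping.lookup t"
  have deg: "total_degree t = l" and comb: "comb n m ?s = v" and t0: "?s 0 = l - delta n m v"
    and tX: "t \<in> monomials {0..n}" using t by (auto simp: hom_grading_def)
  have "(\<Sum>i\<in>{1..n}. ?s i) = delta n m v"
    using total_degree_split[OF tX] deg t0 l by simp
  then have s: "?s \<in> minimal_reps n m v" using comb by (simp add: minimal_reps_def)
  have tail: "tail_mono n l m v ?s = t"
    using t0 monomials_lookup_eq_0[OF tX] by (intro poly_mapping_eqI) (auto simp: lookup_tail_mono)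
  have "\<not> (\<exists>u. u \<noteq> t \<and> (u, t) \<in> r \<and> hom_grading n m u = hom_grading n m t)"
  proof safe
    fix u assume u: "u \<noteq> t" "(u, t) \<in> r" "hom_grading n m u = hom_grading n m t"
    have uX: "u \<in> monomials {0..n}" using term_order_subset[OF order u(2)] by simp
    have ug: "total_degree u = l" "comb n m (Poly_Mapping.lookup u) = v"
      using u(3) deg comb by (auto simp: hom_grading_def)
    \<comment> \<open>The exponents of \<open>x_1, ..., x_n\<close> sum to at least
      \<open>delta n m v\<close> and the total degree is \<open>l\<close>, so no monomial of the
      fibre has a power of \<open>x_0\<close> above \<open>?s 0\<close>.\<close>
    have "delta n m v \<le> (\<Sum>i\<in>{1..n}. Poly_Mapping.lookup u i)" by (rule delta_le) (simp add: ug)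
    then have "Poly_Mapping.lookup u 0 \<le> ?s 0" using total_degree_split[OF uX] ug(1) t0 by simp
    then consider "Poly_Mapping.lookup u 0 < ?s 0" | "Poly_Mapping.lookup u 0 = ?s 0" by linarith
    then have "(t, u) \<in> r"
    proof cases
      case 1
      then show ?thesis using revlex tX uX deg ug by (auto simp: revlex_smallest_var_def)
    next
      case 2
      then show ?thesis using min[of u] uX ug t0 by (simp add: hom_grading_def)
    qed
    then show False using term_order_antisym[OF order u(2)] u(1) by simp
  qed
  then have "F_tail n l m v ?s \<notin> initial_ideal {0..n} r (fiber_ideal {0..n} (hom_grading n m) :: 'k mpoly set)"
    unfolding F_tail_eq mono_poly_in_initial_fiber_ideal_iff[OF order hom_grading_add] tail .
  then show ?thesis using s by blast
qed

text \<open>The existence of a refining order keeps the claims about all refining orders from being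
  vacuous. In the reverse lexicographic case \<open>s\<close> is chosen before \<open>r'\<close>,
  which is possible because the criterion on the tail speaks only of \<open>r\<close> and the old
  ideal.\<close>

theorem proposition2p7:
  fixes n l :: nat
    and m :: "nat \<Rightarrow> nat ^ 'd"
    and v :: "nat ^ 'd"
    and r :: "mono rel"
    and G :: "'k::alg_closed_field mpoly set"
  assumes "v \<in> affine_semigroup n m"
    and "l > 0"
    and "\<exists>j. coprime l (v $ j)"
    and "delta n m v \<le> l"
    and "term_order {0..n} r"
    and "smallest_var {0..n} r 0"
    and "reduced_groebner_basis {0..n} r (proj_toric_ideal n m) G"
  shows
    "(\<exists>r'. refining_order n r r') \<and>
     (revlex_smallest_var {0..n} r 0 \<longrightarrow>
        (\<exists>s\<in>minimal_reps n m v. \<forall>r'. refining_order n r r' \<longrightarrow>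
           reduced_groebner_basis {0..n + 1} r' (proj_toric_ideal (n + 1) (ext_gens n l m v))
             (G \<union> {F_poly n l m v s}))) \<and>
     (\<forall>s\<in>minimal_reps n m v. \<forall>r'. refining_order n r r' \<longrightarrow>
        minimal_groebner_basis {0..n + 1} r' (proj_toric_ideal (n + 1) (ext_gens n l m v))
          (G \<union> {F_poly n l m v s}) \<and>
        (reduced_groebner_basis {0..n + 1} r' (proj_toric_ideal (n + 1) (ext_gens n l m v))
           (G \<union> {F_poly n l m v s}) \<longleftrightarrow>
         F_tail n l m v s \<notin> initial_ideal {0..n} r (proj_toric_ideal n m :: 'k mpoly set))) \<and>
     (\<forall>s\<in>minimal_reps n m v.
        (proj_toric_ideal (n + 1) (ext_gens n l m v) :: 'k mpoly set) =
          genideal (poly_ring {0..n + 1}) (proj_toric_ideal n m)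
          <+>\<^bsub>poly_ring {0..n + 1}\<^esub> genideal (poly_ring {0..n + 1}) {F_poly n l m v s})"
proof -
  note G = assms(7)[unfolded proj_toric_ideal_eq_fiber_ideal]
  have loc: "adjoined_generator n l m v s" if "s \<in> minimal_reps n m v" for s
    using assms(2-4) that by unfold_locales
  have iff: "reduced_groebner_basis {0..n + 1} r' (fiber_ideal {0..n + 1} (hom_grading (n + 1) (ext_gens n l m v)))
           (G \<union> {F_poly n l m v s}) \<longleftrightarrow>
         F_tail n l m v s \<notin> initial_ideal {0..n} r (fiber_ideal {0..n} (hom_grading n m) :: 'k mpoly set)"
    if "s \<in> minimal_reps n m v" "refining_order n r r'" for s r'
    by (rule adjoined_generator.reduced_groebner_basis_adjoin_iff[OF loc[OF that(1)] assms(5) that(2) G])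
  show ?thesis
    unfolding proj_toric_ideal_eq_fiber_ideal
  proof (intro conjI impI ballI allI)
    show "\<exists>r'. refining_order n r r'" using assms(5) by (rule ex_refining_order)
  next
    assume "revlex_smallest_var {0..n} r 0"
    from ex_irreducible_tail[OF assms(1,4,5) this, where 'k = 'k]
    show "\<exists>s\<in>minimal_reps n m v. \<forall>r'. refining_order n r r' \<longrightarrow>
           reduced_groebner_basis {0..n + 1} r' (fiber_ideal {0..n + 1} (hom_grading (n + 1) (ext_gens n l m v)))
             (G \<union> {F_poly n l m v s})"
      using iff by blast
  qed (use iff adjoined_generator.minimal_groebner_basis_adjoin[OF loc assms(5) _ G]
      adjoined_generator.fiber_ideal_eq_sum[OF loc] in blast)+
qed

end
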